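(* The set $\iota(X,\xi)$ is invariant under coarse equivalences: if $f\colon(X,\xi)\to(Y,\eta)$ is a coarse equivalence between pointed coarse spaces, then $\iota(X,\xi)$ and $\iota(Y,\eta)$ are in bijection via the induced map $\iota f$.
   Context: Work in a nonstandard universe, with extension map $A\mapsto{}^{\ast}A$, satisfying the transfer principle and the saturation principle (every family of internal sets that has the finite intersection property and is indexed by a standard set has nonempty intersection). A coarse structure on a set $X$ is a family $\mathcal{C}_X$ of binary relations on $X$ that contains the diagonal $\Delta_X$ and is closed under subsets, finite unions, compositions and inverses; a coarse space is a set with a coarse structure. A set $B\subseteq X$ is bounded if $B\times B\in\mathcal{C}_X$. A pointed coarse space $(X,\xi)$ is a coarse space $X$ with a base point $\xi\in X$; maps $f\colon(X,\xi)\to(Y,\eta)$ satisfy $f(\xi)=\eta$. Such a map is proper if the inverse image of each bounded set of $Y$ containing $\eta$ is bounded in $X$; it is bornologous if $(f\times f)(E)\in\mathcal{C}_Y$ for all $E\in\mathcal{C}_X$; it is coarse if it is proper and bornologous. Two maps $f,g\colon X\to Y$ are bornotopic (close) if $\{(f(x),g(x)) : x\in X\}\in\mathcal{C}_Y$. A coarse map $f\colon(X,\xi)\to(Y,\eta)$ is a coarse equivalence if there is a coarse map $g\colon(Y,\eta)\to(X,\xi)$ such that $g\circ f$ is bornotopic to $\mathrm{id}_X$ and $f\circ g$ is bornotopic to $\mathrm{id}_Y$. For $x,y\in{}^{\ast}X$ write $x\sim_X y$ (finitely close) if $(x,y)\in{}^{\ast}E$ for some $E\in\mathcal{C}_X$.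 Let $\mathrm{FIN}(X,\xi)=\{x\in{}^{\ast}X : x\sim_X\xi\}$ and $\mathrm{INF}(X,\xi)={}^{\ast}X\setminus\mathrm{FIN}(X,\xi)$. For $x,y\in\mathrm{INF}(X,\xi)$ write $x\equiv^{\iota}_{X,\xi}y$ if there are $n\in{}^{\ast}\mathbb{N}$ and an internal hyperfinite sequence $\{s_i\}_{i\le n}$ of points of $\mathrm{INF}(X,\xi)$ with $s_0=x$, $s_n=y$ and $s_i\sim_X s_{i+1}$ for all $i<n$. This is an equivalence relation; $[x]^{\iota}_{X,\xi}$ denotes the class of $x$, and $\iota(X,\xi)=\{[x]^{\iota}_{X,\xi} : x\in\mathrm{INF}(X,\xi)\}$. A coarse map $f\colon(X,\xi)\to(Y,\eta)$ induces the (well-defined) map $\iota f\colon\iota(X,\xi)\to\iota(Y,\eta)$, $\iota f([x]^{\iota}_{X,\xi})=[{}^{\ast}f(x)]^{\iota}_{Y,\eta}$. *)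

theory Defs
  imports Main
begin

section \<open>Coarse spaces\<close>

definition coarse_structure :: "'a set \<Rightarrow> ('a \<times> 'a) set set \<Rightarrow> bool" where
  "coarse_structure X C \<longleftrightarrow>
     (\<forall>E\<in>C. E \<subseteq> X \<times> X) \<and> Id_on X \<in> C \<and>
     (\<forall>E\<in>C. \<forall>F. F \<subseteq> E \<longrightarrow> F \<in> C) \<and>
     (\<forall>E\<in>C. \<forall>F\<in>C. E \<union> F \<in> C) \<and>
     (\<forall>E\<in>C. \<forall>F\<in>C. E O F \<in> C) \<and>
     (\<forall>E\<in>C. E\<inverse> \<in> C)"

definition pointed_coarse_space :: "'a set \<Rightarrow> ('a \<times> 'a) set set \<Rightarrow> 'a \<Rightarrow> bool" where
  "pointed_coarse_space X C \<xi> \<longleftrightarrow> coarse_structure X C \<and> \<xi> \<in> X"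

definition coarse_bounded :: "'a set \<Rightarrow> ('a \<times> 'a) set set \<Rightarrow> 'a set \<Rightarrow> bool" where
  "coarse_bounded X C B \<longleftrightarrow> B \<subseteq> X \<and> B \<times> B \<in> C"

definition pointed_map :: "'a set \<Rightarrow> 'a \<Rightarrow> 'b set \<Rightarrow> 'b \<Rightarrow> ('a \<Rightarrow> 'b) \<Rightarrow> bool" where
  "pointed_map X \<xi> Y \<eta> f \<longleftrightarrow> f ` X \<subseteq> Y \<and> f \<xi> = \<eta>"

definition proper_map ::
  "'a set \<Rightarrow> ('a \<times> 'a) set set \<Rightarrow> 'b set \<Rightarrow> ('b \<times> 'b) set set \<Rightarrow> 'b \<Rightarrow> ('a \<Rightarrow> 'b) \<Rightarrow> bool" where
  "proper_map X CX Y CY \<eta> f \<longleftrightarrow>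
     (\<forall>B. coarse_bounded Y CY B \<and> \<eta> \<in> B \<longrightarrow> coarse_bounded X CX {x \<in> X. f x \<in> B})"

definition bornologous ::
  "('a \<times> 'a) set set \<Rightarrow> ('b \<times> 'b) set set \<Rightarrow> ('a \<Rightarrow> 'b) \<Rightarrow> bool" where
  "bornologous CX CY f \<longleftrightarrow> (\<forall>E\<in>CX. map_prod f f ` E \<in> CY)"

definition coarse_map ::
  "'a set \<Rightarrow> ('a \<times> 'a) set set \<Rightarrow> 'a \<Rightarrow> 'b set \<Rightarrow> ('b \<times> 'b) set set \<Rightarrow> 'b \<Rightarrow> ('a \<Rightarrow> 'b) \<Rightarrow> bool" where
  "coarse_map X CX \<xi> Y CY \<eta> f \<longleftrightarrow>
     pointed_map X \<xi> Y \<eta> f \<and> proper_map X CX Y CY \<eta> f \<and> bornologous CX CY f"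

definition bornotopic ::
  "'a set \<Rightarrow> ('b \<times> 'b) set set \<Rightarrow> ('a \<Rightarrow> 'b) \<Rightarrow> ('a \<Rightarrow> 'b) \<Rightarrow> bool" where
  "bornotopic X CY f g \<longleftrightarrow> {(f x, g x) | x. x \<in> X} \<in> CY"

definition coarse_equivalence ::
  "'a set \<Rightarrow> ('a \<times> 'a) set set \<Rightarrow> 'a \<Rightarrow> 'b set \<Rightarrow> ('b \<times> 'b) set set \<Rightarrow> 'b \<Rightarrow> ('a \<Rightarrow> 'b) \<Rightarrow> bool" where
  "coarse_equivalence X CX \<xi> Y CY \<eta> f \<longleftrightarrow>
     coarse_map X CX \<xi> Y CY \<eta> f \<and>
     (\<exists>g. coarse_map Y CY \<eta> X CX \<xi> g \<and> bornotopic X CX (g \<circ> f) id \<and> bornotopic Y CY (f \<circ> g) id)"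


section \<open>Nonstandard universes\<close>

subsection \<open>Membership structures\<close>

text \<open>
  A universe of sets is a type with a membership relation \<open>e\<close>, read \<open>e x a\<close> as
  ``\<open>x\<close> is an element of \<open>a\<close>''. Ordered pairs inside a universe are Kuratowski pairs.
\<close>

definition elts :: "('w \<Rightarrow> 'w \<Rightarrow> bool) \<Rightarrow> 'w \<Rightarrow> 'w set" where
  "elts e a = {x. e x a}"

definition is_pair :: "('w \<Rightarrow> 'w \<Rightarrow> bool) \<Rightarrow> 'w \<Rightarrow> 'w \<Rightarrow> 'w \<Rightarrow> bool" where
  "is_pair e p x y \<longleftrightarrow> (\<exists>u v. elts e u = {x} \<and> elts e v = {x, y} \<and> elts e p = {u, v})"

definition pairs_of :: "('w \<Rightarrow> 'w \<Rightarrow> bool) \<Rightarrow> ('w \<times> 'w) set \<Rightarrow> 'w set" where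
  "pairs_of e R = {p. \<exists>x y. (x, y) \<in> R \<and> is_pair e p x y}"

definition rel_of :: "('w \<Rightarrow> 'w \<Rightarrow> bool) \<Rightarrow> 'w \<Rightarrow> ('w \<times> 'w) set" where
  "rel_of e r = {(x, y). \<exists>p. e p r \<and> is_pair e p x y}"

subsection \<open>Bounded formulas\<close>

text \<open>
  Bounded formulas of the language of set theory, with de Bruijn indices: in
  \<open>BAll n \<phi>\<close> the bound is variable \<open>n\<close> of the outer context, and variable \<open>0\<close> of \<open>\<phi>\<close> is
  the quantified one. The remaining connectives and the bounded existential quantifier
  are definable.
\<close>

datatype bfm = Mem nat nat | Eql nat nat | Neg bfm | Conj bfm bfm | BAll nat bfm

primrec sat :: "('w \<Rightarrow> 'w \<Rightarrow> bool) \<Rightarrow> (nat \<Rightarrow> 'w) \<Rightarrow> bfm \<Rightarrow> bool" where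
  "sat e \<rho> (Mem i j) \<longleftrightarrow> e (\<rho> i) (\<rho> j)"
| "sat e \<rho> (Eql i j) \<longleftrightarrow> \<rho> i = \<rho> j"
| "sat e \<rho> (Neg \<phi>) \<longleftrightarrow> \<not> sat e \<rho> \<phi>"
| "sat e \<rho> (Conj \<phi> \<psi>) \<longleftrightarrow> sat e \<rho> \<phi> \<and> sat e \<rho> \<psi>"
| "sat e \<rho> (BAll n \<phi>) \<longleftrightarrow> (\<forall>x. e x (\<rho> n) \<longrightarrow> sat e (case_nat x \<rho>) \<phi>)"

subsection \<open>The standard universe and its extension\<close>

text \<open>
  The standard universe has membership \<open>smem\<close>, the nonstandard one \<open>nmem\<close>; \<open>star\<close> is the
  map sending an element \<open>a\<close> of the standard universe to \<open>\<^sup>*a\<close>; \<open>num\<close> represents the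
  natural numbers in the standard universe (they may, but need not, be the finite von
  Neumann ordinals; in a superstructure they are individuals).
\<close>

record ('u, 'v) nsuniv =
  smem :: "'u \<Rightarrow> 'u \<Rightarrow> bool"
  nmem :: "'v \<Rightarrow> 'v \<Rightarrow> bool"
  star :: "'u \<Rightarrow> 'v"
  num  :: "nat \<Rightarrow> 'u"

text \<open>
  A set of elements of the standard universe is \<^emph>\<open>standard\<close> if it is the extension of an
  element of that universe. An element of the nonstandard universe is \<^emph>\<open>internal\<close> if it
  belongs to some \<open>\<^sup>*a\<close>.
\<close>

definition standard_set :: "('u, 'v) nsuniv \<Rightarrow> 'u set \<Rightarrow> bool" where
  "standard_set U A \<longleftrightarrow> (\<exists>a. elts (smem U) a = A)"

definition internal :: "('u, 'v) nsuniv \<Rightarrow> 'v \<Rightarrow> bool" where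
  "internal U s \<longleftrightarrow> (\<exists>a. nmem U s (star U a))"

text \<open>
  The closure conditions on the standard universe hold in every superstructure and in
  every level \<open>V\<^sub>\<lambda>\<close> of the cumulative hierarchy with \<open>\<lambda> > \<omega>\<close> a limit. Extensionality is
  restricted to nonempty sets, so that individuals are allowed. Instead of all power sets
  we only ask for sets containing all finite subsets; this is weaker (by
  \<open>std_subset\<close>, power sets provide such sets), and no type of HOL closed under full power
  sets and containing an infinite set can be shown to exist.
\<close>

locale standard_universe =
  fixes U :: "('u, 'v) nsuniv"
  assumes std_ext: "elts (smem U) a = elts (smem U) b \<Longrightarrow> elts (smem U) a \<noteq> {} \<Longrightarrow> a = b"
    and std_subset: "standard_set U A \<Longrightarrow> B \<subseteq> A \<Longrightarrow> standard_set U B"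
    and std_pair: "standard_set U {x, y}"
    and std_Union: "standard_set U A \<Longrightarrow> standard_set U (\<Union>a\<in>A. elts (smem U) a)"
    and std_Times: "standard_set U A \<Longrightarrow> standard_set U B
      \<Longrightarrow> standard_set U (pairs_of (smem U) (A \<times> B))"
    and std_finite_subsets: "standard_set U A
      \<Longrightarrow> \<exists>P. standard_set U P \<and> (\<forall>F. finite F \<and> F \<subseteq> A \<longrightarrow> (\<exists>b\<in>P. elts (smem U) b = F))"
    and std_num: "inj (num U)" "standard_set U (range (num U))"

text \<open>
  The parameters in \<open>transfer_principle\<close> are the values of \<open>\<rho>\<close>. In \<open>saturation\<close> the
  internal sets \<open>A i\<close> are indexed by the elements \<open>i\<close> of a standard set \<open>I\<close>.
\<close>

locale nonstandard_universe = standard_universe +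
  assumes transfer_principle: "sat (smem U) \<rho> \<phi> \<longleftrightarrow> sat (nmem U) (star U \<circ> \<rho>) \<phi>"
    and saturation: "standard_set U I \<Longrightarrow> (\<And>i. i \<in> I \<Longrightarrow> internal U (A i))
      \<Longrightarrow> (\<And>J. finite J \<Longrightarrow> J \<subseteq> I \<Longrightarrow> J \<noteq> {} \<Longrightarrow> (\<Inter>i\<in>J. elts (nmem U) (A i)) \<noteq> {})
      \<Longrightarrow> (\<Inter>i\<in>I. elts (nmem U) (A i)) \<noteq> {}"

subsection \<open>Extensions of sets, relations and maps\<close>

definition code :: "('u, 'v) nsuniv \<Rightarrow> 'u set \<Rightarrow> 'u" where
  "code U A = (SOME a. elts (smem U) a = A)"

definition star_set :: "('u, 'v) nsuniv \<Rightarrow> 'u set \<Rightarrow> 'v set" where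
  "star_set U A = elts (nmem U) (star U (code U A))"

definition star_rel :: "('u, 'v) nsuniv \<Rightarrow> ('u \<times> 'u) set \<Rightarrow> ('v \<times> 'v) set" where
  "star_rel U R = rel_of (nmem U) (star U (code U (pairs_of (smem U) R)))"

text \<open>The extension of the map \<open>f\<close> restricted to \<open>X\<close>, via its graph; used on \<open>\<^sup>*X\<close> only.\<close>

definition star_map :: "('u, 'v) nsuniv \<Rightarrow> 'u set \<Rightarrow> ('u \<Rightarrow> 'u) \<Rightarrow> 'v \<Rightarrow> 'v" where
  "star_map U X f x = (THE y. (x, y) \<in> star_rel U {(z, f z) | z. z \<in> X})"

definition internal_rel :: "('u, 'v) nsuniv \<Rightarrow> ('v \<times> 'v) set \<Rightarrow> bool" where
  "internal_rel U R \<longleftrightarrow>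
     (\<exists>s. internal U s \<and> (\<forall>p. nmem U p s \<longrightarrow> (\<exists>x y. is_pair (nmem U) p x y)) \<and>
          rel_of (nmem U) s = R)"

subsection \<open>Hypernatural numbers\<close>

definition hnat :: "('u, 'v) nsuniv \<Rightarrow> 'v set" where
  "hnat U = star_set U (range (num U))"

definition hzero :: "('u, 'v) nsuniv \<Rightarrow> 'v" where
  "hzero U = star U (num U 0)"

definition hsuc :: "('u, 'v) nsuniv \<Rightarrow> 'v \<Rightarrow> 'v" where
  "hsuc U = star_map U (range (num U)) (\<lambda>u. num U (Suc (inv (num U) u)))"

definition hle :: "('u, 'v) nsuniv \<Rightarrow> ('v \<times> 'v) set" where
  "hle U = star_rel U {(num U i, num U j) | i j. i \<le> j}"

definition hless :: "('u, 'v) nsuniv \<Rightarrow> ('v \<times> 'v) set" where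
  "hless U = star_rel U {(num U i, num U j) | i j. i < j}"


section \<open>Components at infinity\<close>

definition finitely_close :: "('u, 'v) nsuniv \<Rightarrow> ('u \<times> 'u) set set \<Rightarrow> 'v \<Rightarrow> 'v \<Rightarrow> bool" where
  "finitely_close U C x y \<longleftrightarrow> (\<exists>E\<in>C. (x, y) \<in> star_rel U E)"

definition FIN_pts :: "('u, 'v) nsuniv \<Rightarrow> 'u set \<Rightarrow> ('u \<times> 'u) set set \<Rightarrow> 'u \<Rightarrow> 'v set" where
  "FIN_pts U X C \<xi> = {x \<in> star_set U X. finitely_close U C x (star U \<xi>)}"

definition INF_pts :: "('u, 'v) nsuniv \<Rightarrow> 'u set \<Rightarrow> ('u \<times> 'u) set set \<Rightarrow> 'u \<Rightarrow> 'v set" where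
  "INF_pts U X C \<xi> = star_set U X - FIN_pts U X C \<xi>"

text \<open>
  A hyperfinite sequence \<open>{s\<^sub>i}\<^sub>i\<^sub>\<le>\<^sub>n\<close> is given by a function \<open>s\<close> of which only the values at
  hypernatural \<open>i \<le> n\<close> matter; it is internal if its graph over these \<open>i\<close> is.
\<close>

definition iota_equiv ::
  "('u, 'v) nsuniv \<Rightarrow> 'u set \<Rightarrow> ('u \<times> 'u) set set \<Rightarrow> 'u \<Rightarrow> 'v \<Rightarrow> 'v \<Rightarrow> bool" where
  "iota_equiv U X C \<xi> x y \<longleftrightarrow>
     x \<in> INF_pts U X C \<xi> \<and> y \<in> INF_pts U X C \<xi> \<and>
     (\<exists>n\<in>hnat U. \<exists>s.
        internal_rel U {(i, s i) | i. i \<in> hnat U \<and> (i, n) \<in> hle U} \<and>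
        (\<forall>i\<in>hnat U. (i, n) \<in> hle U \<longrightarrow> s i \<in> INF_pts U X C \<xi>) \<and>
        s (hzero U) = x \<and> s n = y \<and>
        (\<forall>i\<in>hnat U. (i, n) \<in> hless U \<longrightarrow> finitely_close U C (s i) (s (hsuc U i))))"

definition iota_class ::
  "('u, 'v) nsuniv \<Rightarrow> 'u set \<Rightarrow> ('u \<times> 'u) set set \<Rightarrow> 'u \<Rightarrow> 'v \<Rightarrow> 'v set" where
  "iota_class U X C \<xi> x = {y. iota_equiv U X C \<xi> x y}"

definition iota ::
  "('u, 'v) nsuniv \<Rightarrow> 'u set \<Rightarrow> ('u \<times> 'u) set set \<Rightarrow> 'u \<Rightarrow> 'v set set" where
  "iota U X C \<xi> = iota_class U X C \<xi> ` INF_pts U X C \<xi>"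

definition iota_map ::
  "('u, 'v) nsuniv \<Rightarrow> 'u set \<Rightarrow> 'u set \<Rightarrow> ('u \<times> 'u) set set \<Rightarrow> 'u \<Rightarrow> ('u \<Rightarrow> 'u)
    \<Rightarrow> 'v set \<Rightarrow> 'v set" where
  "iota_map U X Y CY \<eta> f c = (THE d. \<exists>x\<in>c. d = iota_class U Y CY \<eta> (star_map U X f x))"

end

theory Submission
  imports Defs
begin

text \<open>
  A coarse map \<open>f\<close> has an extension that preserves \<open>\<sim>\<close> (because \<open>f\<close> is bornologous, lemma
  \<open>finitely_close_star_map\<close>) and sends infinite points to infinite points (because \<open>f\<close> is
  proper, lemma \<open>star_map_INF\<close>). Applying it to every term of an internal hyperfinite chain
  therefore gives such a chain in the target, so that \<open>x \<equiv>\<^sup>\<iota> y\<close> implies \<open>\<^sup>*f x \<equiv>\<^sup>\<iota> \<^sup>*f y\<close> (lemma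
  \<open>iota_equiv_star_map\<close>). If \<open>g\<close> is a coarse inverse of \<open>f\<close>, then \<open>\<^sup>*g (\<^sup>*f x) \<sim> x\<close> for all \<open>x\<close> (lemma
  \<open>bornotopic_id_close\<close>), and infinite points that are finitely close are equivalent. As
  \<open>\<equiv>\<^sup>\<iota>\<close> is an equivalence relation, the maps induced by \<open>f\<close> and \<open>g\<close> are inverse to each other.

  The work lies in the internality of the chains: constant chains, images of chains, and the chain
  that runs along a first one and then backwards along a second one must be internal. Each
  of the three is obtained by transfer of the corresponding statement about finite
  sequences. No power set is needed for this: a finite sequence in \<open>X\<close> is a finite subset of
  \<open>\<nat> \<times> X\<close>, and the universe has a set that contains all of these. So the chains produced
  belong to the extension of one standard set, whichever internal chains they are made from.
  Bounded formulas are evaluated in both universes by \<open>sat\<close>; each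
  property that is transferred is therefore written as a predicate with the membership relation
  as an argument, or as a formula whose evaluation yields it by simplification.
\<close>

section \<open>Bounded formulas for pairs, relations and finite sequences\<close>

text \<open>
  Derived connectives and the bounded existential quantifier, with the index conventions of
  \<open>BAll\<close>.
\<close>

definition Imp :: "bfm \<Rightarrow> bfm \<Rightarrow> bfm" where
  "Imp \<phi> \<psi> = Neg (Conj \<phi> (Neg \<psi>))"

definition Disj :: "bfm \<Rightarrow> bfm \<Rightarrow> bfm" where
  "Disj \<phi> \<psi> = Neg (Conj (Neg \<phi>) (Neg \<psi>))"

definition BEx :: "nat \<Rightarrow> bfm \<Rightarrow> bfm" where
  "BEx n \<phi> = Neg (BAll n (Neg \<phi>))"

lemma sat_connectives [simp]:
  "sat e \<rho> (Imp \<phi> \<psi>) \<longleftrightarrow> (sat e \<rho> \<phi> \<longrightarrow> sat e \<rho> \<psi>)"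
  "sat e \<rho> (Disj \<phi> \<psi>) \<longleftrightarrow> sat e \<rho> \<phi> \<or> sat e \<rho> \<psi>"
  "sat e \<rho> (BEx n \<phi>) \<longleftrightarrow> (\<exists>x. e x (\<rho> n) \<and> sat e (case_nat x \<rho>) \<phi>)"
  by (auto simp: Imp_def Disj_def BEx_def)

text \<open>
  The formula saying that variable \<open>p\<close> is the Kuratowski pair of the variables \<open>x\<close> and \<open>y\<close>.
  Here and below a quantifier shifts the indices of all outer variables by one.
\<close>

definition Pair_fm :: "nat \<Rightarrow> nat \<Rightarrow> nat \<Rightarrow> bfm" where
  "Pair_fm p x y =
     BEx p (BEx (Suc p)
       (Conj (Conj (Mem (x+2) 1) (BAll 1 (Eql 0 (x+3))))
       (Conj (Conj (Mem (x+2) 0) (Conj (Mem (y+2) 0)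
               (BAll 0 (Disj (Eql 0 (x+3)) (Eql 0 (y+3))))))
             (BAll (p+2) (Disj (Eql 0 2) (Eql 0 1))))))"

lemma sat_Pair_fm [simp]:
  "sat e \<rho> (Pair_fm p x y) \<longleftrightarrow> is_pair e (\<rho> p) (\<rho> x) (\<rho> y)"
proof -
  have *: "elts e u = {a} \<longleftrightarrow> e a u \<and> (\<forall>z. e z u \<longrightarrow> z = a)"
    "elts e u = {a, b} \<longleftrightarrow> e a u \<and> e b u \<and> (\<forall>z. e z u \<longrightarrow> z = a \<or> z = b)" for u a b
    by (auto simp: elts_def)
  show ?thesis
    unfolding is_pair_def * by (auto simp: Pair_fm_def eval_nat_numeral)
qed

text \<open>
  The formula saying that the pair of \<open>x\<close> and \<open>y\<close> belongs to \<open>r\<close>.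
\<close>

definition Rel_fm :: "nat \<Rightarrow> nat \<Rightarrow> nat \<Rightarrow> bfm" where
  "Rel_fm r x y = BEx r (Pair_fm 0 (Suc x) (Suc y))"

lemma sat_Rel_fm [simp]:
  "sat e \<rho> (Rel_fm r x y) \<longleftrightarrow> (\<rho> x, \<rho> y) \<in> rel_of e (\<rho> r)"
  by (auto simp: Rel_fm_def rel_of_def)

text \<open>
  The set \<open>t\<close> is the graph of a sequence \<open>{t\<^sub>i}\<^sub>i\<^sub>\<le>\<^sub>n\<close> of elements of \<open>X\<close>, where \<open>N\<close> is the set of
  natural numbers and \<open>L\<close> the graph of their order. All quantifiers are bounded, so that
  the predicate is expressed by a bounded formula. It is used with \<open>e\<close> the membership of either
  universe.
\<close>

definition is_seq :: "('w \<Rightarrow> 'w \<Rightarrow> bool) \<Rightarrow> 'w \<Rightarrow> 'w \<Rightarrow> 'w \<Rightarrow> 'w \<Rightarrow> 'w \<Rightarrow> bool" where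
  "is_seq e N L X n t \<longleftrightarrow>
     (\<forall>p. e p t \<longrightarrow> (\<exists>i. e i N \<and> (i, n) \<in> rel_of e L \<and> (\<exists>x. e x X \<and> is_pair e p i x))) \<and>
     (\<forall>i. e i N \<longrightarrow> (i, n) \<in> rel_of e L \<longrightarrow>
        (\<exists>x. e x X \<and> (i, x) \<in> rel_of e t \<and> (\<forall>y. e y X \<longrightarrow> (i, y) \<in> rel_of e t \<longrightarrow> y = x)))"

text \<open>
  The elements \<open>x\<close> and \<open>y\<close> are consecutive terms of the sequence \<open>t\<close>; \<open>S\<close> is the graph of the
  successor map on \<open>N\<close>. The length of \<open>t\<close> need not be mentioned, since \<open>t\<close> has no terms
  beyond it.
\<close>

definition is_step :: "('w \<Rightarrow> 'w \<Rightarrow> bool) \<Rightarrow> 'w \<Rightarrow> 'w \<Rightarrow> 'w \<Rightarrow> 'w \<Rightarrow> 'w \<Rightarrow> bool" where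
  "is_step e N S t x y \<longleftrightarrow>
     (\<exists>i. e i N \<and> (\<exists>j. e j N \<and> (i, j) \<in> rel_of e S \<and> (i, x) \<in> rel_of e t \<and> (j, y) \<in> rel_of e t))"

text \<open>
  The bounded formulas expressing \<open>is_seq\<close> and \<open>is_step\<close>.
\<close>

definition Seq_fm :: "nat \<Rightarrow> nat \<Rightarrow> nat \<Rightarrow> nat \<Rightarrow> nat \<Rightarrow> bfm" where
  "Seq_fm N L X n t =
     Conj (BAll t (BEx (N+1) (Conj (Rel_fm (L+2) 0 (n+2)) (BEx (X+2) (Pair_fm 2 1 0)))))
          (BAll N (Imp (Rel_fm (L+1) 0 (n+1))
             (BEx (X+1) (Conj (Rel_fm (t+2) 1 0)
                (BAll (X+2) (Imp (Rel_fm (t+3) 2 0) (Eql 0 1)))))))"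

definition Step_fm :: "nat \<Rightarrow> nat \<Rightarrow> nat \<Rightarrow> nat \<Rightarrow> nat \<Rightarrow> bfm" where
  "Step_fm N S t x y =
     BEx N (BEx (N+1) (Conj (Rel_fm (S+2) 1 0) (Conj (Rel_fm (t+2) 1 (x+2)) (Rel_fm (t+2) 0 (y+2)))))"

lemma sat_Seq_fm [simp]:
  "sat e \<rho> (Seq_fm N L X n t) \<longleftrightarrow> is_seq e (\<rho> N) (\<rho> L) (\<rho> X) (\<rho> n) (\<rho> t)"
  by (simp add: Seq_fm_def is_seq_def eval_nat_numeral)

lemma sat_Step_fm [simp]:
  "sat e \<rho> (Step_fm N S t x y) \<longleftrightarrow> is_step e (\<rho> N) (\<rho> S) (\<rho> t) (\<rho> x) (\<rho> y)"
  by (simp add: Step_fm_def is_step_def eval_nat_numeral)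

text \<open>
  What is needed of the sequence \<open>{t\<^sub>i}\<^sub>i\<^sub>\<le>\<^sub>k\<close> that runs along \<open>s\<close> to its end \<open>s\<^sub>n\<close>, jumps to the
  end \<open>s'\<^sub>m\<close> of \<open>s'\<close>, and runs along \<open>s'\<close> backwards: it starts where \<open>s\<close> starts and ends where \<open>s'\<close>
  starts, each of its steps is a step of \<open>s\<close>, a reversed step of \<open>s'\<close>, or the jump, and its terms
  are terms of \<open>s\<close> or \<open>s'\<close>. The element \<open>Z\<close> is the number zero.
\<close>

definition joins :: "('w \<Rightarrow> 'w \<Rightarrow> bool) \<Rightarrow> 'w \<Rightarrow> 'w \<Rightarrow> 'w \<Rightarrow> 'w \<Rightarrow> 'w \<Rightarrow> 'w \<Rightarrow> 'w \<Rightarrow> 'w \<Rightarrow> 'w \<Rightarrow> 'w \<Rightarrow> bool" where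
  "joins e N Z S X s n s' m t k \<longleftrightarrow>
     (\<forall>x. e x X \<longrightarrow> (Z, x) \<in> rel_of e s \<longrightarrow> (Z, x) \<in> rel_of e t) \<and>
     (\<forall>x. e x X \<longrightarrow> (Z, x) \<in> rel_of e s' \<longrightarrow> (k, x) \<in> rel_of e t) \<and>
     (\<forall>x. e x X \<longrightarrow> (\<forall>y. e y X \<longrightarrow> is_step e N S t x y \<longrightarrow>
        is_step e N S s x y \<or> is_step e N S s' y x \<or> (n, x) \<in> rel_of e s \<and> (m, y) \<in> rel_of e s')) \<and>
     (\<forall>i. e i N \<longrightarrow> (\<forall>x. e x X \<longrightarrow> (i, x) \<in> rel_of e t \<longrightarrow>
        (\<exists>j. e j N \<and> ((j, x) \<in> rel_of e s \<or> (j, x) \<in> rel_of e s'))))"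

text \<open>
  The bounded formula expressing \<open>joins\<close>.
\<close>

definition Joins_fm ::
  "nat \<Rightarrow> nat \<Rightarrow> nat \<Rightarrow> nat \<Rightarrow> nat \<Rightarrow> nat \<Rightarrow> nat \<Rightarrow> nat \<Rightarrow> nat \<Rightarrow> nat \<Rightarrow> bfm" where
  "Joins_fm N Z S X s n s' m t k =
     Conj (BAll X (Imp (Rel_fm (s+1) (Z+1) 0) (Rel_fm (t+1) (Z+1) 0)))
    (Conj (BAll X (Imp (Rel_fm (s'+1) (Z+1) 0) (Rel_fm (t+1) (k+1) 0)))
    (Conj (BAll X (BAll (X+1) (Imp (Step_fm (N+2) (S+2) (t+2) 1 0)
             (Disj (Step_fm (N+2) (S+2) (s+2) 1 0) (Disj (Step_fm (N+2) (S+2) (s'+2) 0 1)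
                (Conj (Rel_fm (s+2) (n+2) 1) (Rel_fm (s'+2) (m+2) 0)))))))
          (BAll N (BAll (X+1) (Imp (Rel_fm (t+2) 1 0)
             (BEx (N+2) (Disj (Rel_fm (s+3) 0 1) (Rel_fm (s'+3) 0 1))))))))"

lemma sat_Joins_fm [simp]:
  "sat e \<rho> (Joins_fm N Z S X s n s' m t k) \<longleftrightarrow>
     joins e (\<rho> N) (\<rho> Z) (\<rho> S) (\<rho> X) (\<rho> s) (\<rho> n) (\<rho> s') (\<rho> m) (\<rho> t) (\<rho> k)"
  by (simp add: Joins_fm_def joins_def eval_nat_numeral)

text \<open>
  Kuratowski pairs determine their components without any appeal to extensionality; so
  this holds in the nonstandard universe too.
\<close>

lemma is_pair_inject:
  assumes "is_pair e p x y" "is_pair e p x' y'"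
  shows "x = x' \<and> y = y'"
proof -
  obtain u v where 1: "elts e u = {x}" "elts e v = {x, y}" "elts e p = {u, v}"
    using assms(1) by (auto simp: is_pair_def)
  obtain u' v' where 2: "elts e u' = {x'}" "elts e v' = {x', y'}" "elts e p = {u', v'}"
    using assms(2) by (auto simp: is_pair_def)
  have "u = u' \<and> v = v' \<or> u = v' \<and> v = u'"
    using 1(3) 2(3) by (metis doubleton_eq_iff)
  then show ?thesis
    using 1 2 by (auto simp: doubleton_eq_iff)
qed

lemma is_seq_relD:
  assumes "is_seq e N L X n t" "(i, x) \<in> rel_of e t"
  shows "e i N" "(i, n) \<in> rel_of e L" "e x X"
proof -
  obtain p where p: "e p t" "is_pair e p i x"
    using assms(2) by (auto simp: rel_of_def)
  obtain j y where "e j N" "(j, n) \<in> rel_of e L" "e y X" "is_pair e p j y"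
    using assms(1) p(1) unfolding is_seq_def by blast
  with is_pair_inject[OF p(2)] show "e i N" "(i, n) \<in> rel_of e L" "e x X"
    by auto
qed

lemma is_seq_ex:
  assumes "is_seq e N L X n t" "e i N" "(i, n) \<in> rel_of e L"
  shows "\<exists>x. e x X \<and> (i, x) \<in> rel_of e t"
  using assms unfolding is_seq_def by blast

lemma is_seq_unique:
  assumes "is_seq e N L X n t" "(i, x) \<in> rel_of e t" "(i, y) \<in> rel_of e t"
  shows "x = y"
  using assms(1) is_seq_relD[OF assms(1,2)] is_seq_relD[OF assms(1,3)] assms(2,3)
  unfolding is_seq_def by metis


section \<open>Codes of standard sets and relations\<close>

context standard_universe
begin

lemma elts_code: "standard_set U A \<Longrightarrow> elts (smem U) (code U A) = A"
  unfolding standard_set_def code_def by (rule someI_ex)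

lemma smem_code: "standard_set U A \<Longrightarrow> smem U x (code U A) \<longleftrightarrow> x \<in> A"
  using elts_code[of A] by (auto simp: elts_def)

lemma pair_exists: "\<exists>p. is_pair (smem U) p x y"
proof -
  obtain u where u: "elts (smem U) u = {x}"
    using std_pair[of x x] by (auto simp: standard_set_def)
  obtain v where v: "elts (smem U) v = {x, y}"
    using std_pair[of x y] by (auto simp: standard_set_def)
  obtain p where "elts (smem U) p = {u, v}"
    using std_pair[of u v] by (auto simp: standard_set_def)
  with u v show ?thesis by (auto simp: is_pair_def)
qed

lemma rel_of_code:
  assumes "standard_set U A" "standard_set U B" "R \<subseteq> A \<times> B"
  shows "rel_of (smem U) (code U (pairs_of (smem U) R)) = R"
proof -
  have "pairs_of (smem U) R \<subseteq> pairs_of (smem U) (A \<times> B)"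
    using assms(3) by (auto simp: pairs_of_def)
  then have s: "standard_set U (pairs_of (smem U) R)"
    using std_subset std_Times assms(1,2) by blast
  have *: "(x, y) \<in> rel_of (smem U) (code U (pairs_of (smem U) R))
      \<longleftrightarrow> (\<exists>p\<in>pairs_of (smem U) R. is_pair (smem U) p x y)" for x y
    by (auto simp: rel_of_def smem_code[OF s])
  show ?thesis
  proof (intro equalityI subrelI)
    fix x y assume "(x, y) \<in> rel_of (smem U) (code U (pairs_of (smem U) R))"
    then obtain p x' y' where "is_pair (smem U) p x y" "is_pair (smem U) p x' y'" "(x', y') \<in> R"
      unfolding * unfolding pairs_of_def by blast
    with is_pair_inject[OF this(1,2)] show "(x, y) \<in> R" by simp
  next
    fix x y assume "(x, y) \<in> R"
    with pair_exists[of x y] show "(x, y) \<in> rel_of (smem U) (code U (pairs_of (smem U) R))"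
      unfolding * unfolding pairs_of_def by blast
  qed
qed

text \<open>
  The set of natural numbers, their order and the successor map, as elements of the standard
  universe. The description of the successor map is the one used for \<open>hsuc\<close>.
\<close>

abbreviation nats :: 'u where
  "nats \<equiv> code U (range (num U))"

abbreviation le_graph :: 'u where
  "le_graph \<equiv> code U (pairs_of (smem U) {(num U i, num U j) | i j. i \<le> j})"

abbreviation suc_graph :: 'u where
  "suc_graph \<equiv> code U (pairs_of (smem U)
     {(z, num U (Suc (inv (num U) z))) | z. z \<in> range (num U)})"

lemma smem_nats [simp]: "smem U x nats \<longleftrightarrow> x \<in> range (num U)"
  using smem_code std_num(2) by blast

lemma num_eq [simp]: "num U i = num U j \<longleftrightarrow> i = j"
  using std_num(1) by (auto dest: injD)

lemma rel_of_le_graph [simp]: "(num U i, num U j) \<in> rel_of (smem U) le_graph \<longleftrightarrow> i \<le> j"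
  by (subst rel_of_code[OF std_num(2) std_num(2)]) auto

lemma rel_of_suc_graph [simp]: "(num U i, num U j) \<in> rel_of (smem U) suc_graph \<longleftrightarrow> j = Suc i"
  by (subst rel_of_code[OF std_num(2) std_num(2)]) (auto simp: inv_f_f[OF std_num(1)])

text \<open>
  An element of the standard universe to which all finite sequences in a standard set \<open>X\<close> belong.
  It may have further elements.
\<close>

definition fin_seqs :: "'u set \<Rightarrow> 'u" where
  "fin_seqs X = (SOME P. \<forall>F. finite F \<and> F \<subseteq> pairs_of (smem U) (range (num U) \<times> X)
     \<longrightarrow> (\<exists>b. smem U b P \<and> elts (smem U) b = F))"

lemma fin_seqs:
  assumes "standard_set U X" "finite F" "F \<subseteq> pairs_of (smem U) (range (num U) \<times> X)"
  shows "\<exists>b. smem U b (fin_seqs X) \<and> elts (smem U) b = F"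
proof -
  obtain P where P: "standard_set U P" "\<forall>F. finite F \<and> F \<subseteq> pairs_of (smem U) (range (num U) \<times> X)
      \<longrightarrow> (\<exists>b\<in>P. elts (smem U) b = F)"
    using std_finite_subsets[OF std_Times[OF std_num(2) assms(1)]] by blast
  have "\<exists>P. \<forall>F. finite F \<and> F \<subseteq> pairs_of (smem U) (range (num U) \<times> X)
      \<longrightarrow> (\<exists>b. smem U b P \<and> elts (smem U) b = F)"
    by (rule exI[of _ "code U P"]) (use P smem_code in blast)
  from someI_ex[OF this] show ?thesis
    unfolding fin_seqs_def[symmetric] using assms(2,3) by blast
qed

lemma std_seq_exists:
  assumes X: "standard_set U X" and a: "\<And>i. i \<le> n \<Longrightarrow> a i \<in> X"
  obtains t where "smem U t (fin_seqs X)" "is_seq (smem U) nats le_graph (code U X) (num U n) t"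
    "rel_of (smem U) t = {(num U i, a i) | i. i \<le> n}"
proof -
  obtain c where c: "is_pair (smem U) (c i) (num U i) (a i)" for i
    using choice[of "\<lambda>i p. is_pair (smem U) p (num U i) (a i)"] pair_exists by blast
  have "c ` {..n} \<subseteq> pairs_of (smem U) (range (num U) \<times> X)"
    using c a by (fastforce simp: pairs_of_def)
  then obtain t where t: "smem U t (fin_seqs X)" "elts (smem U) t = c ` {..n}"
    using fin_seqs[OF X, of "c ` {..n}"] by auto
  have m: "smem U p t \<longleftrightarrow> (\<exists>i\<le>n. p = c i)" for p
    using t(2) by (auto simp: elts_def)
  have r: "rel_of (smem U) t = {(num U i, a i) | i. i \<le> n}"
  proof (intro equalityI subrelI)
    fix k x assume "(k, x) \<in> rel_of (smem U) t"
    then obtain i where "i \<le> n" "is_pair (smem U) (c i) k x"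
      by (auto simp: rel_of_def m)
    with is_pair_inject[OF this(2) c] show "(k, x) \<in> {(num U i, a i) | i. i \<le> n}"
      by auto
  qed (use c in \<open>auto simp: rel_of_def m\<close>)
  have "is_seq (smem U) nats le_graph (code U X) (num U n) t"
    unfolding is_seq_def
  proof (intro conjI allI impI)
    fix p assume "smem U p t"
    then obtain i where "i \<le> n" "p = c i" by (auto simp: m)
    with c[of i] a[of i] show "\<exists>i. smem U i nats \<and> (i, num U n) \<in> rel_of (smem U) le_graph \<and>
        (\<exists>x. smem U x (code U X) \<and> is_pair (smem U) p i x)"
      by (intro exI[of _ "num U i"]) (auto simp: smem_code[OF X])
  qed (use a in \<open>auto simp: r smem_code[OF X]\<close>)
  with t(1) r show thesis using that by blast
qed

lemma std_seqE:
  assumes X: "standard_set U X" and s: "is_seq (smem U) nats le_graph (code U X) (num U n) s"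
  obtains a where "\<And>i. i \<le> n \<Longrightarrow> a i \<in> X" "rel_of (smem U) s = {(num U i, a i) | i. i \<le> n}"
proof -
  have "\<forall>i. \<exists>x. i \<le> n \<longrightarrow> x \<in> X \<and> (num U i, x) \<in> rel_of (smem U) s"
    using is_seq_ex[OF s] by (fastforce simp: smem_code[OF X])
  from choice[OF this]
  obtain a where a: "i \<le> n \<longrightarrow> a i \<in> X \<and> (num U i, a i) \<in> rel_of (smem U) s" for i
    by blast
  have "rel_of (smem U) s = {(num U i, a i) | i. i \<le> n}"
  proof (intro equalityI subrelI)
    fix k x assume k: "(k, x) \<in> rel_of (smem U) s"
    with is_seq_relD[OF s k] obtain i where "k = num U i" "i \<le> n" by auto
    with a[of i] is_seq_unique[OF s k] show "(k, x) \<in> {(num U i, a i) | i. i \<le> n}" by auto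
  qed (use a in auto)
  with a that show thesis by blast
qed

lemma is_step_std:
  assumes "rel_of (smem U) s = {(num U i, a i) | i. i \<le> n}"
  shows "is_step (smem U) nats suc_graph s x y \<longleftrightarrow> (\<exists>i<n. x = a i \<and> y = a (Suc i))"
proof -
  have "(num U i, z) \<in> rel_of (smem U) s \<longleftrightarrow> i \<le> n \<and> z = a i" for i z
    by (auto simp: assms)
  then show ?thesis
    by (auto simp: is_step_def Suc_le_eq) (use less_imp_le_nat in blast)
qed

text \<open>
  The two facts about finite sequences that are transferred below: two sequences can be
  joined, the second one being reversed, and a map can be applied to all terms of a sequence.
\<close>

lemma std_join:
  assumes X: "standard_set U X"
    and p: "smem U p nats" and q: "smem U q nats"
    and s: "is_seq (smem U) nats le_graph (code U X) p s"
    and s': "is_seq (smem U) nats le_graph (code U X) q s'"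
  shows "\<exists>k. smem U k nats \<and> (\<exists>t. smem U t (fin_seqs X) \<and>
    is_seq (smem U) nats le_graph (code U X) k t \<and>
    joins (smem U) nats (num U 0) suc_graph (code U X) s p s' q t k)"
proof -
  obtain n m where pq: "p = num U n" "q = num U m"
    using p q by auto
  obtain a where a: "\<And>i. i \<le> n \<Longrightarrow> a i \<in> X" "rel_of (smem U) s = {(num U i, a i) | i. i \<le> n}"
    using std_seqE[OF X s[unfolded pq]] by blast
  obtain b where b: "\<And>i. i \<le> m \<Longrightarrow> b i \<in> X" "rel_of (smem U) s' = {(num U i, b i) | i. i \<le> m}"
    using std_seqE[OF X s'[unfolded pq]] by blast
  \<comment> \<open>The terms are \<open>a 0, \<dots>, a n, b m, \<dots>, b 0\<close>, with indices from \<open>0\<close> to \<open>n + m + 1\<close>.\<close>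
  define k where "k = Suc (n + m)"
  define c where "c i = (if i \<le> n then a i else b (k - i))" for i
  have cX: "c i \<in> X" if "i \<le> k" for i
    using that a(1) b(1) by (auto simp: c_def k_def)
  obtain t where t: "smem U t (fin_seqs X)"
    "is_seq (smem U) nats le_graph (code U X) (num U k) t"
    "rel_of (smem U) t = {(num U i, c i) | i. i \<le> k}"
    by (rule std_seq_exists[OF X cX])
  note st = is_step_std[OF a(2)] is_step_std[OF b(2)] is_step_std[OF t(3)]
  have "joins (smem U) nats (num U 0) suc_graph (code U X) s (num U n) s' (num U m) t (num U k)"
    unfolding joins_def
  proof (intro conjI allI impI)
    fix x assume "(num U 0, x) \<in> rel_of (smem U) s"
    then show "(num U 0, x) \<in> rel_of (smem U) t"
      by (auto simp: a(2) t(3) c_def)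
  next
    fix x assume "(num U 0, x) \<in> rel_of (smem U) s'"
    then show "(num U k, x) \<in> rel_of (smem U) t"
      by (auto simp: b(2) t(3) c_def k_def)
  next
    fix x y assume "is_step (smem U) nats suc_graph t x y"
    then obtain i where i: "i < k" "x = c i" "y = c (Suc i)"
      by (auto simp: st)
    consider "i < n" | "i = n" | "n < i" by linarith
    then show "is_step (smem U) nats suc_graph s x y \<or> is_step (smem U) nats suc_graph s' y x \<or>
        (num U n, x) \<in> rel_of (smem U) s \<and> (num U m, y) \<in> rel_of (smem U) s'"
    proof cases
      case 1
      with i show ?thesis by (auto simp: st c_def)
    next
      case 2
      with i show ?thesis by (auto simp: a(2) b(2) c_def k_def)
    next
      case 3
      with i have "k - Suc i < m" "x = b (Suc (k - Suc i))" "y = b (k - Suc i)"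
        by (auto simp: c_def k_def Suc_diff_le)
      then show ?thesis by (auto simp: st)
    qed
  next
    fix i x assume "(i, x) \<in> rel_of (smem U) t"
    then obtain j where j: "j \<le> k" "x = c j" by (auto simp: t(3))
    show "\<exists>j. smem U j nats \<and> ((j, x) \<in> rel_of (smem U) s \<or> (j, x) \<in> rel_of (smem U) s')"
    proof (cases "j \<le> n")
      case True
      with j show ?thesis by (intro exI[of _ "num U j"]) (auto simp: a(2) c_def)
    next
      case False
      with j show ?thesis by (intro exI[of _ "num U (k - j)"]) (auto simp: b(2) c_def k_def)
    qed
  qed
  with t(1,2) show ?thesis unfolding pq by auto
qed

lemma std_image:
  assumes X: "standard_set U X" and Y: "standard_set U Y" and f: "f ` X \<subseteq> Y"
    and s: "is_seq (smem U) nats le_graph (code U X) (num U n) s"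
  shows "\<exists>t. smem U t (fin_seqs Y) \<and> is_seq (smem U) nats le_graph (code U Y) (num U n) t \<and>
    (\<forall>i. smem U i nats \<longrightarrow> (\<forall>y. smem U y (code U Y) \<longrightarrow> (i, y) \<in> rel_of (smem U) t \<longrightarrow>
      (\<exists>x. smem U x (code U X) \<and> (i, x) \<in> rel_of (smem U) s \<and> y = f x)))"
proof -
  obtain a where a: "\<And>i. i \<le> n \<Longrightarrow> a i \<in> X" "rel_of (smem U) s = {(num U i, a i) | i. i \<le> n}"
    using std_seqE[OF X s] by blast
  have fa: "f (a i) \<in> Y" if "i \<le> n" for i
    using that a(1) f by blast
  obtain t where "smem U t (fin_seqs Y)" "is_seq (smem U) nats le_graph (code U Y) (num U n) t"
    "rel_of (smem U) t = {(num U i, f (a i)) | i. i \<le> n}"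
    using std_seq_exists[OF Y, of n "\<lambda>i. f (a i)"] fa by blast
  then show ?thesis
    by (intro exI[of _ t]) (auto simp: a smem_code[OF X])
qed

end


section \<open>Transfer of relations and maps\<close>

context nonstandard_universe
begin

lemma nmem_star: "nmem U (star U x) (star U a) \<longleftrightarrow> smem U x a"
  using transfer_principle[of "(!) [x, a]" "Mem 0 1"] by simp

lemma star_in_star_set: "standard_set U A \<Longrightarrow> x \<in> A \<Longrightarrow> star U x \<in> star_set U A"
  by (simp add: star_set_def elts_def nmem_star smem_code)

lemma star_rel_star:
  assumes "standard_set U A" "standard_set U B" "R \<subseteq> A \<times> B"
  shows "(star U x, star U y) \<in> star_rel U R \<longleftrightarrow> (x, y) \<in> R"
  using transfer_principle[of "(!) [code U (pairs_of (smem U) R), x, y]" "Rel_fm 0 1 2"]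
  by (simp add: star_rel_def rel_of_code[OF assms])

lemma star_rel_subset:
  assumes A: "standard_set U A" and B: "standard_set U B" and R: "R \<subseteq> A \<times> B"
  shows "star_rel U R \<subseteq> star_set U A \<times> star_set U B"
proof -
  let ?r = "code U (pairs_of (smem U) R)"
  have s: "standard_set U (pairs_of (smem U) R)"
    by (rule std_subset[OF std_Times[OF A B]]) (use R in \<open>auto simp: pairs_of_def\<close>)
  have "\<forall>p. smem U p ?r \<longrightarrow> (\<exists>x. smem U x (code U A) \<and> (\<exists>y. smem U y (code U B) \<and> is_pair (smem U) p x y))"
    unfolding smem_code[OF s] smem_code[OF A] smem_code[OF B]
    unfolding pairs_of_def using R by blast
  then have "\<forall>p. nmem U p (star U ?r) \<longrightarrow> (\<exists>x. nmem U x (star U (code U A)) \<and>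
      (\<exists>y. nmem U y (star U (code U B)) \<and> is_pair (nmem U) p x y))"
    using transfer_principle[of "(!) [?r, code U A, code U B]"
        "BAll 0 (BEx 2 (BEx 4 (Pair_fm 2 1 0)))"] by simp
  then show ?thesis
    by (fastforce simp: star_rel_def star_set_def elts_def rel_of_def dest: is_pair_inject)
qed

text \<open>
  Nearly all facts about extensions of relations that are needed reduce to this
  inclusion and to converses: the relevant closure property is written as an inclusion of
  a composition, with maps represented by their graphs.
\<close>

lemma star_rel_comp:
  assumes A: "standard_set U A" and B: "standard_set U B" and C: "standard_set U C"
    and R: "R \<subseteq> A \<times> B" and S: "S \<subseteq> B \<times> C" and T: "T \<subseteq> A \<times> C" and RS: "R O S \<subseteq> T"
  shows "star_rel U R O star_rel U S \<subseteq> star_rel U T"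
proof -
  let ?c = "\<lambda>R. code U (pairs_of (smem U) R)"
  have "\<forall>x. smem U x (code U A) \<longrightarrow> (\<forall>y. smem U y (code U B) \<longrightarrow> (\<forall>z. smem U z (code U C) \<longrightarrow>
      (x, y) \<in> rel_of (smem U) (?c R) \<longrightarrow> (y, z) \<in> rel_of (smem U) (?c S) \<longrightarrow>
      (x, z) \<in> rel_of (smem U) (?c T)))"
    using RS by (auto simp: rel_of_code[OF A B R] rel_of_code[OF B C S] rel_of_code[OF A C T])
  then have "\<forall>x. nmem U x (star U (code U A)) \<longrightarrow> (\<forall>y. nmem U y (star U (code U B)) \<longrightarrow>
      (\<forall>z. nmem U z (star U (code U C)) \<longrightarrow>
      (x, y) \<in> star_rel U R \<longrightarrow> (y, z) \<in> star_rel U S \<longrightarrow> (x, z) \<in> star_rel U T))"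
    using transfer_principle[of "(!) [code U A, code U B, code U C, ?c R, ?c S, ?c T]"
        "BAll 0 (BAll 2 (BAll 4 (Imp (Rel_fm 6 2 1) (Imp (Rel_fm 7 1 0) (Rel_fm 8 2 0)))))"]
    by (simp add: star_rel_def)
  then show ?thesis
    using star_rel_subset[OF A B R] star_rel_subset[OF B C S]
    by (fastforce simp: star_set_def elts_def)
qed

lemma star_rel_converse:
  assumes A: "standard_set U A" and B: "standard_set U B" and R: "R \<subseteq> A \<times> B"
    and xy: "(x, y) \<in> star_rel U R"
  shows "(y, x) \<in> star_rel U (R\<inverse>)"
proof -
  let ?c = "\<lambda>R. code U (pairs_of (smem U) R)"
  have R': "R\<inverse> \<subseteq> B \<times> A" using R by auto
  have "\<forall>x. smem U x (code U A) \<longrightarrow> (\<forall>y. smem U y (code U B) \<longrightarrow>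
      (x, y) \<in> rel_of (smem U) (?c R) \<longrightarrow> (y, x) \<in> rel_of (smem U) (?c (R\<inverse>)))"
    by (auto simp: rel_of_code[OF A B R] rel_of_code[OF B A R'])
  then have "\<forall>x. nmem U x (star U (code U A)) \<longrightarrow> (\<forall>y. nmem U y (star U (code U B)) \<longrightarrow>
      (x, y) \<in> star_rel U R \<longrightarrow> (y, x) \<in> star_rel U (R\<inverse>))"
    using transfer_principle[of "(!) [code U A, code U B, ?c R, ?c (R\<inverse>)]"
        "BAll 0 (BAll 2 (Imp (Rel_fm 4 1 0) (Rel_fm 5 0 1)))"]
    by (simp add: star_rel_def)
  then show ?thesis
    using star_rel_subset[OF A B R] xy by (fastforce simp: star_set_def elts_def)
qed

lemma star_rel_Id_on:
  assumes A: "standard_set U A"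
  shows "star_rel U (Id_on A) = Id_on (star_set U A)"
proof -
  let ?d = "code U (pairs_of (smem U) (Id_on A))"
  have sub: "Id_on A \<subseteq> A \<times> A" by auto
  have "\<forall>x. smem U x (code U A) \<longrightarrow> (\<forall>y. smem U y (code U A) \<longrightarrow>
      ((x, y) \<in> rel_of (smem U) ?d \<longrightarrow> x = y) \<and> (x = y \<longrightarrow> (x, y) \<in> rel_of (smem U) ?d))"
    by (auto simp: rel_of_code[OF A A sub] smem_code[OF A])
  then have "\<forall>x. nmem U x (star U (code U A)) \<longrightarrow> (\<forall>y. nmem U y (star U (code U A)) \<longrightarrow>
      ((x, y) \<in> star_rel U (Id_on A) \<longrightarrow> x = y) \<and> (x = y \<longrightarrow> (x, y) \<in> star_rel U (Id_on A)))"
    using transfer_principle[of "(!) [code U A, ?d]"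
        "BAll 0 (BAll 1 (Conj (Imp (Rel_fm 3 1 0) (Eql 1 0)) (Imp (Eql 1 0) (Rel_fm 3 1 0))))"]
    by (simp add: star_rel_def)
  then show ?thesis
    using star_rel_subset[OF A A sub] by (fastforce simp: star_set_def elts_def)
qed

lemma star_rel_mono:
  assumes A: "standard_set U A" and B: "standard_set U B" and "R \<subseteq> S" "S \<subseteq> A \<times> B"
  shows "star_rel U R \<subseteq> star_rel U S"
proof -
  have R: "R \<subseteq> A \<times> B" using assms by blast
  have "star_rel U (Id_on A) O star_rel U R \<subseteq> star_rel U S"
    by (rule star_rel_comp[OF A A B _ R]) (use assms in auto)
  then show ?thesis
    using star_rel_subset[OF A B R] by (auto simp: star_rel_Id_on[OF A])
qed

text \<open>
  The graph of \<open>f\<close> restricted to \<open>A\<close>, in the form used by \<open>star_map\<close>.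
\<close>

abbreviation graph where
  "graph A f \<equiv> {(z, f z) | z. z \<in> A}"

lemma star_graph_unique:
  assumes A: "standard_set U A" and B: "standard_set U B" and f: "f ` A \<subseteq> B"
    and xy: "(x, y) \<in> star_rel U (graph A f)" and xy': "(x, y') \<in> star_rel U (graph A f)"
  shows "y = y'"
proof -
  have F: "graph A f \<subseteq> A \<times> B" using f by auto
  have "star_rel U ((graph A f)\<inverse>) O star_rel U (graph A f) \<subseteq> star_rel U (Id_on B)"
    by (rule star_rel_comp[OF B A B _ F]) (use f in auto)
  then have "(y, y') \<in> star_rel U (Id_on B)"
    using star_rel_converse[OF A B F xy] xy' by blast
  then show ?thesis by (simp add: star_rel_Id_on[OF B] Id_on_iff)
qed

lemma star_map_graph:
  assumes A: "standard_set U A" and B: "standard_set U B" and f: "f ` A \<subseteq> B"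
    and x: "x \<in> star_set U A"
  shows "(x, star_map U A f x) \<in> star_rel U (graph A f)"
proof -
  let ?g = "code U (pairs_of (smem U) (graph A f))"
  have F: "graph A f \<subseteq> A \<times> B" using f by auto
  have "\<forall>x. smem U x (code U A) \<longrightarrow> (\<exists>y. smem U y (code U B) \<and> (x, y) \<in> rel_of (smem U) ?g)"
    using f by (auto simp: rel_of_code[OF A B F] smem_code A B)
  then have "\<forall>x. nmem U x (star U (code U A)) \<longrightarrow>
      (\<exists>y. nmem U y (star U (code U B)) \<and> (x, y) \<in> star_rel U (graph A f))"
    using transfer_principle[of "(!) [code U A, code U B, ?g]" "BAll 0 (BEx 2 (Rel_fm 4 1 0))"]
    by (simp add: star_rel_def)
  then obtain y where y: "(x, y) \<in> star_rel U (graph A f)"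
    using x by (auto simp: star_set_def elts_def)
  show ?thesis
    unfolding star_map_def
    by (rule theI, rule y) (rule star_graph_unique[OF A B f _ y])
qed

lemma star_map_eqI:
  assumes "standard_set U A" "standard_set U B" "f ` A \<subseteq> B" "(x, y) \<in> star_rel U (graph A f)"
  shows "star_map U A f x = y"
  unfolding star_map_def
  by (rule the_equality, rule assms(4)) (rule star_graph_unique[OF assms(1-3) _ assms(4)])

lemma star_map_in:
  assumes A: "standard_set U A" and B: "standard_set U B" and f: "f ` A \<subseteq> B"
    and x: "x \<in> star_set U A"
  shows "star_map U A f x \<in> star_set U B"
proof -
  have "graph A f \<subseteq> A \<times> B" using f by auto
  from star_rel_subset[OF A B this] star_map_graph[OF assms] show ?thesis by blast
qed


section \<open>Hypernatural numbers\<close>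

lemma hle_refl: "n \<in> hnat U \<Longrightarrow> (n, n) \<in> hle U"
proof -
  have "star_rel U (Id_on (range (num U))) \<subseteq> hle U"
    unfolding hle_def by (rule star_rel_mono[OF std_num(2) std_num(2)]) auto
  then show "n \<in> hnat U \<Longrightarrow> (n, n) \<in> hle U"
    by (auto simp: hnat_def star_rel_Id_on[OF std_num(2)])
qed

lemma hzero_in: "hzero U \<in> hnat U"
  by (simp add: hzero_def hnat_def star_in_star_set std_num(2))

lemma hzero_le: "n \<in> hnat U \<Longrightarrow> (hzero U, n) \<in> hle U"
proof -
  have "\<forall>n. smem U n nats \<longrightarrow> (num U 0, n) \<in> rel_of (smem U) le_graph"
    by auto
  then have "\<forall>n. nmem U n (star U nats) \<longrightarrow> (hzero U, n) \<in> hle U"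
    using transfer_principle[of "(!) [nats, num U 0, le_graph]" "BAll 0 (Rel_fm 3 2 0)"]
    by (simp add: hle_def star_rel_def hzero_def)
  then show "n \<in> hnat U \<Longrightarrow> (hzero U, n) \<in> hle U"
    by (simp add: hnat_def star_set_def elts_def)
qed

abbreviation hsuc_rel where
  "hsuc_rel \<equiv> rel_of (nmem U) (star U suc_graph)"

lemma hsuc_rel_iff: "(i, j) \<in> hsuc_rel \<longleftrightarrow> i \<in> hnat U \<and> j = hsuc U i"
proof -
  let ?s = "\<lambda>u. num U (Suc (inv (num U) u))" and ?N = "range (num U)"
  note N = std_num(2)
  have s: "?s ` ?N \<subseteq> ?N" by auto
  have g: "hsuc_rel = star_rel U (graph ?N ?s)" by (simp add: star_rel_def)
  have "graph ?N ?s \<subseteq> ?N \<times> ?N" by auto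
  note sub = star_rel_subset[OF N N this]
  show ?thesis
    using star_map_graph[OF N N s, of i] star_map_eqI[OF N N s, of i j] sub
    unfolding g hsuc_def hnat_def by blast
qed

lemma hsuc_in: "i \<in> hnat U \<Longrightarrow> hsuc U i \<in> hnat U"
  unfolding hnat_def hsuc_def by (rule star_map_in[OF std_num(2) std_num(2)]) auto

lemma hless_imp_hle: "(i, n) \<in> hless U \<Longrightarrow> (i, n) \<in> hle U"
proof -
  have "hless U \<subseteq> hle U"
    unfolding hle_def hless_def by (rule star_rel_mono[OF std_num(2) std_num(2)]) auto
  then show "(i, n) \<in> hless U \<Longrightarrow> (i, n) \<in> hle U" by blast
qed

lemma hless_iff_hsuc_le:
  assumes i: "i \<in> hnat U"
  shows "(i, n) \<in> hless U \<longleftrightarrow> (hsuc U i, n) \<in> hle U"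
proof -
  let ?s = "\<lambda>u. num U (Suc (inv (num U) u))" and ?N = "range (num U)"
  note N = std_num(2)
  have s: "graph ?N ?s \<subseteq> ?N \<times> ?N" by auto
  have 1: "star_rel U (graph ?N ?s) O hle U \<subseteq> hless U"
    unfolding hle_def hless_def
    by (rule star_rel_comp[OF N N N]) (auto simp: inv_f_f[OF std_num(1)])
  have 2: "star_rel U ((graph ?N ?s)\<inverse>) O hless U \<subseteq> hle U"
    unfolding hle_def hless_def
    by (rule star_rel_comp[OF N N N]) (auto simp: inv_f_f[OF std_num(1)])
  have 3: "(i, hsuc U i) \<in> star_rel U (graph ?N ?s)"
    using i hsuc_rel_iff by (simp add: star_rel_def)
  show ?thesis
    using 1 2 3 star_rel_converse[OF N N s 3] by blast
qed


section \<open>Internal hyperfinite sequences\<close>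

text \<open>
  The relation coded by an element of the nonstandard universe, hyperfinite sequences in
  \<open>\<^sup>*X\<close> indexed by \<open>{0..n}\<close>, and their steps.
\<close>

abbreviation nrel where
  "nrel t \<equiv> rel_of (nmem U) t"

abbreviation hseq where
  "hseq X n t \<equiv> is_seq (nmem U) (star U nats) (star U le_graph) (star U (code U X)) n t"

abbreviation hstep where
  "hstep t x y \<equiv> is_step (nmem U) (star U nats) (star U suc_graph) t x y"

lemma nmem_nats: "nmem U i (star U nats) \<longleftrightarrow> i \<in> hnat U"
  by (simp add: hnat_def star_set_def elts_def)

lemma star_nats: "star_set U (range (num U)) = hnat U"
  by (simp add: hnat_def)

lemma nmem_code: "nmem U x (star U (code U X)) \<longleftrightarrow> x \<in> star_set U X"
  by (simp add: star_set_def elts_def)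

lemma nrel_le_graph: "nrel (star U le_graph) = hle U"
  by (simp add: hle_def star_rel_def)

lemma hseq_relD:
  assumes "hseq X n t" "(i, x) \<in> nrel t"
  shows "i \<in> hnat U" "(i, n) \<in> hle U" "x \<in> star_set U X"
  using is_seq_relD[OF assms] by (simp_all add: nmem_code star_nats nrel_le_graph)

lemma hseq_ex:
  assumes "hseq X n t" "i \<in> hnat U" "(i, n) \<in> hle U"
  obtains x where "(i, x) \<in> nrel t"
  using is_seq_ex[OF assms(1), of i] assms(2,3) by (auto simp: nmem_nats nrel_le_graph)

lemma hstep_iff:
  assumes "hseq X n t"
  shows "hstep t x y \<longleftrightarrow> (\<exists>i. (i, x) \<in> nrel t \<and> (hsuc U i, y) \<in> nrel t)"
  using hseq_relD[OF assms] by (auto simp: is_step_def nmem_nats hsuc_rel_iff)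

text \<open>
  The equivalence of infinite points in terms of coded sequences, the form to which the transferred
  facts apply.
\<close>

lemma iota_equiv_iff:
  "iota_equiv U X C \<xi> x y \<longleftrightarrow>
    (\<exists>n\<in>hnat U. \<exists>t. internal U t \<and> hseq X n t \<and> (hzero U, x) \<in> nrel t \<and> (n, y) \<in> nrel t \<and>
       (\<forall>i z. (i, z) \<in> nrel t \<longrightarrow> z \<in> INF_pts U X C \<xi>) \<and>
       (\<forall>z w. hstep t z w \<longrightarrow> finitely_close U C z w))" (is "_ \<longleftrightarrow> ?R")
proof
  assume "iota_equiv U X C \<xi> x y"
  then obtain n s where n: "n \<in> hnat U"
    and int: "internal_rel U {(i, s i) | i. i \<in> hnat U \<and> (i, n) \<in> hle U}"
    and inf: "\<forall>i\<in>hnat U. (i, n) \<in> hle U \<longrightarrow> s i \<in> INF_pts U X C \<xi>"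
    and ends: "s (hzero U) = x" "s n = y"
    and close: "\<forall>i\<in>hnat U. (i, n) \<in> hless U \<longrightarrow> finitely_close U C (s i) (s (hsuc U i))"
    unfolding iota_equiv_def by blast
  obtain t where t: "internal U t" "\<forall>p. nmem U p t \<longrightarrow> (\<exists>x y. is_pair (nmem U) p x y)"
    "nrel t = {(i, s i) | i. i \<in> hnat U \<and> (i, n) \<in> hle U}"
    using int unfolding internal_rel_def by blast
  have r: "(i, z) \<in> nrel t \<longleftrightarrow> i \<in> hnat U \<and> (i, n) \<in> hle U \<and> z = s i" for i z
    by (auto simp: t(3))
  have sX: "s i \<in> star_set U X" if "i \<in> hnat U" "(i, n) \<in> hle U" for i
    using inf that by (auto simp: INF_pts_def)
  have seq: "hseq X n t"
    unfolding is_seq_def nmem_code star_nats nrel_le_graph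
  proof (intro conjI allI impI)
    fix p assume p: "nmem U p t"
    with t(2) obtain i z where iz: "is_pair (nmem U) p i z" by blast
    with p have "(i, z) \<in> nrel t" unfolding rel_of_def by blast
    with iz sX show "\<exists>i. i \<in> hnat U \<and> (i, n) \<in> hle U \<and> (\<exists>x. x \<in> star_set U X \<and> is_pair (nmem U) p i x)"
      unfolding r by blast
  next
    fix i assume "i \<in> hnat U" "(i, n) \<in> hle U"
    with sX show "\<exists>x. x \<in> star_set U X \<and> (i, x) \<in> nrel t \<and>
        (\<forall>y. y \<in> star_set U X \<longrightarrow> (i, y) \<in> nrel t \<longrightarrow> y = x)"
      unfolding r by blast
  qed
  have steps: "finitely_close U C z w" if zw: "hstep t z w" for z w
  proof -
    obtain i where "(i, z) \<in> nrel t" "(hsuc U i, w) \<in> nrel t"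
      using zw by (auto simp: hstep_iff[OF seq])
    with close show ?thesis by (auto simp: r hless_iff_hsuc_le)
  qed
  show ?R
    by (rule bexI[OF _ n], rule exI[of _ t])
      (use t(1) seq steps inf ends n in \<open>auto simp: r hzero_in hzero_le hle_refl\<close>)
next
  assume ?R
  then obtain n t where n: "n \<in> hnat U" and t: "internal U t" and seq: "hseq X n t"
    and ends: "(hzero U, x) \<in> nrel t" "(n, y) \<in> nrel t"
    and inf: "\<And>i z. (i, z) \<in> nrel t \<Longrightarrow> z \<in> INF_pts U X C \<xi>"
    and close: "\<And>z w. hstep t z w \<Longrightarrow> finitely_close U C z w"
    by blast
  define s where "s i = (THE z. (i, z) \<in> nrel t)" for i
  have s_eq: "s i = z" if "(i, z) \<in> nrel t" for i z
    unfolding s_def by (rule the_equality, rule that) (rule is_seq_unique[OF seq _ that])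
  have s_in: "(i, s i) \<in> nrel t" if "i \<in> hnat U" "(i, n) \<in> hle U" for i
    using hseq_ex[OF seq that] s_eq by metis
  have graph: "nrel t = {(i, s i) | i. i \<in> hnat U \<and> (i, n) \<in> hle U}"
    using s_eq s_in hseq_relD(1,2)[OF seq] by fastforce
  have "internal_rel U {(i, s i) | i. i \<in> hnat U \<and> (i, n) \<in> hle U}"
    unfolding internal_rel_def graph[symmetric] using t seq unfolding is_seq_def by blast
  moreover have "finitely_close U C (s i) (s (hsuc U i))" if "i \<in> hnat U" "(i, n) \<in> hless U" for i
  proof -
    have "(i, s i) \<in> nrel t" "(hsuc U i, s (hsuc U i)) \<in> nrel t"
      using that s_in hsuc_in hless_imp_hle hless_iff_hsuc_le by simp_all
    then show ?thesis by (intro close) (auto simp: hstep_iff[OF seq])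
  qed
  ultimately show "iota_equiv U X C \<xi> x y"
    unfolding iota_equiv_def
    using n inf[OF ends(1)] inf[OF ends(2)] s_eq[OF ends(1)] s_eq[OF ends(2)] inf s_in by blast
qed

text \<open>
  Internal constant sequences, joins and images. The quantifiers over internal sequences
  are bounded by the sets \<open>\<^sup>*a\<close> that contain the given sequences; nothing else is needed about
  these sets.
\<close>

lemma hseq_const:
  assumes X: "standard_set U X" and x: "x \<in> star_set U X"
  obtains t where "internal U t" "hseq X (hzero U) t" "(hzero U, x) \<in> nrel t"
    "\<And>i y. (i, y) \<in> nrel t \<Longrightarrow> y = x"
proof -
  have "\<forall>x. smem U x (code U X) \<longrightarrow> (\<exists>t. smem U t (fin_seqs X) \<and>
      is_seq (smem U) nats le_graph (code U X) (num U 0) t \<and> (num U 0, x) \<in> rel_of (smem U) t \<and>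
      (\<forall>i. smem U i nats \<longrightarrow> (\<forall>y. smem U y (code U X) \<longrightarrow> (i, y) \<in> rel_of (smem U) t \<longrightarrow> y = x)))"
  proof (intro allI impI)
    fix x assume "smem U x (code U X)"
    then have "x \<in> X" by (simp add: smem_code[OF X])
    then obtain t where "smem U t (fin_seqs X)"
      "is_seq (smem U) nats le_graph (code U X) (num U 0) t"
      "rel_of (smem U) t = {(num U i, x) | i. i \<le> 0}"
      using std_seq_exists[OF X, of 0 "\<lambda>_. x"] by blast
    then show "\<exists>t. smem U t (fin_seqs X) \<and>
      is_seq (smem U) nats le_graph (code U X) (num U 0) t \<and> (num U 0, x) \<in> rel_of (smem U) t \<and>
      (\<forall>i. smem U i nats \<longrightarrow> (\<forall>y. smem U y (code U X) \<longrightarrow> (i, y) \<in> rel_of (smem U) t \<longrightarrow> y = x))"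
      by (intro exI[of _ t]) auto
  qed
  then have "\<forall>x. nmem U x (star U (code U X)) \<longrightarrow> (\<exists>t. nmem U t (star U (fin_seqs X)) \<and>
      hseq X (hzero U) t \<and> (hzero U, x) \<in> nrel t \<and>
      (\<forall>i. nmem U i (star U nats) \<longrightarrow> (\<forall>y. nmem U y (star U (code U X)) \<longrightarrow> (i, y) \<in> nrel t \<longrightarrow> y = x)))"
    using transfer_principle[of "(!) [nats, num U 0, le_graph, code U X, fin_seqs X]"
        "BAll 3 (BEx 5 (Conj (Seq_fm 2 4 5 3 0) (Conj (Rel_fm 0 3 1)
           (BAll 2 (BAll 6 (Imp (Rel_fm 2 1 0) (Eql 0 3)))))))"]
    by (simp add: hzero_def)
  then obtain t where t: "nmem U t (star U (fin_seqs X))" "hseq X (hzero U) t" "(hzero U, x) \<in> nrel t"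
    "\<And>i y. i \<in> hnat U \<Longrightarrow> y \<in> star_set U X \<Longrightarrow> (i, y) \<in> nrel t \<Longrightarrow> y = x"
    using x by (auto simp: nmem_code star_nats)
  show thesis
  proof (rule that)
    show "internal U t" using t(1) by (auto simp: internal_def)
    show "y = x" if "(i, y) \<in> nrel t" for i y
      using t(4) hseq_relD[OF t(2) that] that by blast
  qed (fact t)+
qed

lemma hseq_join:
  assumes X: "standard_set U X" and int: "internal U s" "internal U s'"
    and n: "n \<in> hnat U" "m \<in> hnat U" and s: "hseq X n s" and s': "hseq X m s'"
  obtains k t where "k \<in> hnat U" "internal U t" "hseq X k t"
    "joins (nmem U) (star U nats) (hzero U) (star U suc_graph) (star U (code U X)) s n s' m t k"
proof -
  obtain a b where ab: "nmem U s (star U a)" "nmem U s' (star U b)"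
    using int by (auto simp: internal_def)
  have "\<forall>s. smem U s a \<longrightarrow> (\<forall>n. smem U n nats \<longrightarrow> (\<forall>s'. smem U s' b \<longrightarrow> (\<forall>m. smem U m nats \<longrightarrow>
      is_seq (smem U) nats le_graph (code U X) n s \<longrightarrow>
      is_seq (smem U) nats le_graph (code U X) m s' \<longrightarrow>
      (\<exists>k. smem U k nats \<and> (\<exists>t. smem U t (fin_seqs X) \<and>
        is_seq (smem U) nats le_graph (code U X) k t \<and>
        joins (smem U) nats (num U 0) suc_graph (code U X) s n s' m t k)))))"
    using std_join[OF X] by blast
  then have "\<forall>s. nmem U s (star U a) \<longrightarrow> (\<forall>n. nmem U n (star U nats) \<longrightarrow>
      (\<forall>s'. nmem U s' (star U b) \<longrightarrow> (\<forall>m. nmem U m (star U nats) \<longrightarrow>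
      hseq X n s \<longrightarrow> hseq X m s' \<longrightarrow>
      (\<exists>k. nmem U k (star U nats) \<and> (\<exists>t. nmem U t (star U (fin_seqs X)) \<and> hseq X k t \<and>
        joins (nmem U) (star U nats) (hzero U) (star U suc_graph) (star U (code U X)) s n s' m t k)))))"
    using transfer_principle[of "(!) [a, b, nats, num U 0, le_graph, suc_graph, code U X, fin_seqs X]"
        "BAll 0 (BAll 3 (BAll 3 (BAll 5 (Imp (Seq_fm 6 8 10 2 3) (Imp (Seq_fm 6 8 10 0 1)
           (BEx 6 (BEx 12 (Conj (Seq_fm 8 10 12 1 0) (Joins_fm 8 9 11 12 5 4 3 2 0 1)))))))))"]
    by (simp add: hzero_def)
  then obtain k t where "nmem U k (star U nats)" "nmem U t (star U (fin_seqs X))" "hseq X k t"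
    "joins (nmem U) (star U nats) (hzero U) (star U suc_graph) (star U (code U X)) s n s' m t k"
    using ab n s s' unfolding nmem_nats by blast
  with that show thesis unfolding nmem_nats internal_def by blast
qed

lemma hseq_image:
  assumes X: "standard_set U X" and Y: "standard_set U Y" and f: "f ` X \<subseteq> Y"
    and int: "internal U s" and n: "n \<in> hnat U" and s: "hseq X n s"
  obtains t where "internal U t" "hseq Y n t"
    "\<And>i x. (i, x) \<in> nrel t \<longleftrightarrow> (\<exists>z. (i, z) \<in> nrel s \<and> x = star_map U X f z)"
proof -
  obtain a where a: "nmem U s (star U a)"
    using int by (auto simp: internal_def)
  let ?g = "code U (pairs_of (smem U) (graph X f))"
  have F: "graph X f \<subseteq> X \<times> Y" using f by auto
  have "\<forall>s. smem U s a \<longrightarrow> (\<forall>n. smem U n nats \<longrightarrow> is_seq (smem U) nats le_graph (code U X) n s \<longrightarrow>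
      (\<exists>t. smem U t (fin_seqs Y) \<and> is_seq (smem U) nats le_graph (code U Y) n t \<and>
      (\<forall>i. smem U i nats \<longrightarrow> (\<forall>y. smem U y (code U Y) \<longrightarrow> (i, y) \<in> rel_of (smem U) t \<longrightarrow>
        (\<exists>x. smem U x (code U X) \<and> (i, x) \<in> rel_of (smem U) s \<and> (x, y) \<in> rel_of (smem U) ?g)))))"
  proof (intro allI impI)
    fix s n assume n: "smem U n nats" and s: "is_seq (smem U) nats le_graph (code U X) n s"
    obtain k where k: "n = num U k" using n by auto
    obtain t where t: "smem U t (fin_seqs Y)" "is_seq (smem U) nats le_graph (code U Y) n t"
      "\<And>i y. smem U i nats \<Longrightarrow> smem U y (code U Y) \<Longrightarrow> (i, y) \<in> rel_of (smem U) t \<Longrightarrow>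
        \<exists>x. smem U x (code U X) \<and> (i, x) \<in> rel_of (smem U) s \<and> y = f x"
      using std_image[OF X Y f s[unfolded k]] unfolding k by blast
    show "\<exists>t. smem U t (fin_seqs Y) \<and> is_seq (smem U) nats le_graph (code U Y) n t \<and>
      (\<forall>i. smem U i nats \<longrightarrow> (\<forall>y. smem U y (code U Y) \<longrightarrow> (i, y) \<in> rel_of (smem U) t \<longrightarrow>
        (\<exists>x. smem U x (code U X) \<and> (i, x) \<in> rel_of (smem U) s \<and> (x, y) \<in> rel_of (smem U) ?g)))"
    proof (rule exI[of _ t], intro conjI allI impI)
      fix i y assume "smem U i nats" "smem U y (code U Y)" "(i, y) \<in> rel_of (smem U) t"
      from t(3)[OF this] obtain x where x: "smem U x (code U X)" "(i, x) \<in> rel_of (smem U) s" "y = f x"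
        by blast
      then have "(x, y) \<in> graph X f" by (simp add: smem_code[OF X])
      with x(1,2) show "\<exists>x. smem U x (code U X) \<and> (i, x) \<in> rel_of (smem U) s \<and>
          (x, y) \<in> rel_of (smem U) ?g"
        unfolding rel_of_code[OF X Y F] by blast
    qed (fact t(1,2))+
  qed
  then have tr: "\<forall>s. nmem U s (star U a) \<longrightarrow> (\<forall>n. nmem U n (star U nats) \<longrightarrow> hseq X n s \<longrightarrow>
      (\<exists>t. nmem U t (star U (fin_seqs Y)) \<and> hseq Y n t \<and>
      (\<forall>i. nmem U i (star U nats) \<longrightarrow> (\<forall>y. nmem U y (star U (code U Y)) \<longrightarrow> (i, y) \<in> nrel t \<longrightarrow>
        (\<exists>x. nmem U x (star U (code U X)) \<and> (i, x) \<in> nrel s \<and> (x, y) \<in> star_rel U (graph X f))))))"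
    using transfer_principle[of "(!) [a, nats, le_graph, code U X, code U Y, ?g, fin_seqs Y]"
        "BAll 0 (BAll 2 (Imp (Seq_fm 3 4 5 0 1) (BEx 8 (Conj (Seq_fm 4 5 7 1 0)
           (BAll 4 (BAll 8 (Imp (Rel_fm 2 1 0) (BEx 8 (Conj (Rel_fm 5 2 0) (Rel_fm 11 0 1))))))))))"]
    by (simp add: star_rel_def)
  then obtain t where t: "nmem U t (star U (fin_seqs Y))" "hseq Y n t"
    "\<And>i y. i \<in> hnat U \<Longrightarrow> y \<in> star_set U Y \<Longrightarrow> (i, y) \<in> nrel t \<Longrightarrow>
       \<exists>x. (i, x) \<in> nrel s \<and> (x, y) \<in> star_rel U (graph X f)"
    using tr[rule_format, OF a _ s] n unfolding nmem_code star_nats by blast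
  have 1: "\<exists>z. (i, z) \<in> nrel s \<and> x = star_map U X f z" if ix: "(i, x) \<in> nrel t" for i x
  proof -
    obtain z where z: "(i, z) \<in> nrel s" "(z, x) \<in> star_rel U (graph X f)"
      using t(3)[OF _ _ ix] hseq_relD[OF t(2) ix] by blast
    with star_map_eqI[OF X Y f z(2)] show ?thesis by blast
  qed
  have 2: "(i, star_map U X f z) \<in> nrel t" if iz: "(i, z) \<in> nrel s" for i z
  proof -
    obtain x where x: "(i, x) \<in> nrel t"
      using hseq_ex[OF t(2)] hseq_relD[OF s iz] by blast
    with 1 obtain z' where "(i, z') \<in> nrel s" "x = star_map U X f z'" by blast
    with is_seq_unique[OF s iz] x show ?thesis by simp
  qed
  show thesis
  proof (rule that)
    show "internal U t" using t(1) by (auto simp: internal_def)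
    show "hseq Y n t" by (fact t(2))
    show "(i, x) \<in> nrel t \<longleftrightarrow> (\<exists>z. (i, z) \<in> nrel s \<and> x = star_map U X f z)" for i x
      using 1 2 by blast
  qed
qed


section \<open>The finite closeness relation\<close>

lemma finitely_close_refl:
  assumes X: "standard_set U X" and C: "coarse_structure X C" and x: "x \<in> star_set U X"
  shows "finitely_close U C x x"
proof -
  have "Id_on X \<in> C" using C by (auto simp: coarse_structure_def)
  with x show ?thesis
    unfolding finitely_close_def by (intro bexI[of _ "Id_on X"]) (auto simp: star_rel_Id_on[OF X])
qed

lemma finitely_close_sym:
  assumes X: "standard_set U X" and C: "coarse_structure X C" and xy: "finitely_close U C x y"
  shows "finitely_close U C y x"
proof -
  obtain E where E: "E \<in> C" "(x, y) \<in> star_rel U E"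
    using xy by (auto simp: finitely_close_def)
  have "E \<subseteq> X \<times> X" "E\<inverse> \<in> C"
    using C E(1) by (auto simp: coarse_structure_def)
  with star_rel_converse[OF X X _ E(2)] show ?thesis
    by (auto simp: finitely_close_def)
qed

lemma finitely_close_star_map:
  assumes X: "standard_set U X" and CX: "coarse_structure X CX" and Y: "standard_set U Y"
    and f: "f ` X \<subseteq> Y" and born: "bornologous CX CY f" and xy: "finitely_close U CX x y"
  shows "finitely_close U CY (star_map U X f x) (star_map U X f y)"
proof -
  obtain E where E: "E \<in> CX" "(x, y) \<in> star_rel U E"
    using xy by (auto simp: finitely_close_def)
  have sub: "E \<subseteq> X \<times> X" using CX E(1) by (auto simp: coarse_structure_def)
  have F: "graph X f \<subseteq> X \<times> Y" using f by auto
  have EF: "E O graph X f \<subseteq> X \<times> Y" using sub F by blast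
  have xX: "x \<in> star_set U X" "y \<in> star_set U X"
    using star_rel_subset[OF X X sub] E(2) by auto
  have "star_rel U E O star_rel U (graph X f) \<subseteq> star_rel U (E O graph X f)"
    by (rule star_rel_comp[OF X X Y sub F EF]) simp
  then have "(x, star_map U X f y) \<in> star_rel U (E O graph X f)"
    using E(2) star_map_graph[OF X Y f xX(2)] by blast
  moreover have "star_rel U ((graph X f)\<inverse>) O star_rel U (E O graph X f)
      \<subseteq> star_rel U (map_prod f f ` E)"
    by (rule star_rel_comp[OF Y X Y _ EF]) (use sub f in force)+
  ultimately have "(star_map U X f x, star_map U X f y) \<in> star_rel U (map_prod f f ` E)"
    using star_rel_converse[OF X Y F star_map_graph[OF X Y f xX(1)]] by blast
  moreover have "map_prod f f ` E \<in> CY"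
    using born E(1) by (simp add: bornologous_def)
  ultimately show ?thesis by (auto simp: finitely_close_def)
qed

text \<open>
  The ball of radius \<open>E\<close> about the base point is bounded. So properness of a map into \<open>Y\<close> says
  that the preimages of these balls are bounded, which is what keeps infinite points infinite.
\<close>

lemma coarse_bounded_ball:
  assumes CY: "coarse_structure Y CY" and \<eta>: "\<eta> \<in> Y" and E: "E \<in> CY"
  shows "coarse_bounded Y CY (insert \<eta> {y. (y, \<eta>) \<in> E})"
proof -
  let ?E = "E \<union> Id_on Y"
  have E': "?E \<in> CY" using CY E by (auto simp: coarse_structure_def)
  then have "?E\<inverse> \<in> CY" using CY by (auto simp: coarse_structure_def)
  with E' have "?E O ?E\<inverse> \<in> CY" using CY by (auto simp: coarse_structure_def)
  moreover have "insert \<eta> {y. (y, \<eta>) \<in> E} \<times> insert \<eta> {y. (y, \<eta>) \<in> E} \<subseteq> ?E O ?E\<inverse>"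
    using \<eta> by auto
  ultimately have "insert \<eta> {y. (y, \<eta>) \<in> E} \<times> insert \<eta> {y. (y, \<eta>) \<in> E} \<in> CY"
    using CY unfolding coarse_structure_def by blast
  moreover have "E \<subseteq> Y \<times> Y" using CY E by (auto simp: coarse_structure_def)
  ultimately show ?thesis using \<eta> by (auto simp: coarse_bounded_def)
qed

lemma star_map_INF:
  assumes X: "standard_set U X" and PX: "pointed_coarse_space X CX \<xi>"
    and Y: "standard_set U Y" and PY: "pointed_coarse_space Y CY \<eta>"
    and f: "coarse_map X CX \<xi> Y CY \<eta> f" and x: "x \<in> INF_pts U X CX \<xi>"
  shows "star_map U X f x \<in> INF_pts U Y CY \<eta>"
proof -
  have \<xi>: "\<xi> \<in> X" and CY: "coarse_structure Y CY" and \<eta>: "\<eta> \<in> Y"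
    using PX PY by (auto simp: pointed_coarse_space_def)
  have fX: "f ` X \<subseteq> Y" and f\<xi>: "f \<xi> = \<eta>" and proper: "proper_map X CX Y CY \<eta> f"
    using f by (auto simp: coarse_map_def pointed_map_def)
  have xX: "x \<in> star_set U X" using x by (simp add: INF_pts_def)
  have "finitely_close U CX x (star U \<xi>)" if close: "finitely_close U CY (star_map U X f x) (star U \<eta>)"
  proof -
    obtain E where E: "E \<in> CY" "(star_map U X f x, star U \<eta>) \<in> star_rel U E"
      using close by (auto simp: finitely_close_def)
    have sub: "E \<subseteq> Y \<times> Y" using CY E(1) by (auto simp: coarse_structure_def)
    define A where "A = {x \<in> X. f x \<in> insert \<eta> {y. (y, \<eta>) \<in> E}}"
    have A: "A \<times> A \<in> CX"
      using proper coarse_bounded_ball[OF CY \<eta> E(1)] unfolding proper_map_def A_def coarse_bounded_def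
      by blast
    have \<xi>A: "\<xi> \<in> A" using \<xi> f\<xi> by (simp add: A_def)
    have AX: "A \<times> A \<subseteq> X \<times> X" by (auto simp: A_def)
    have sub2: "E O {(\<eta>, \<xi>)} \<subseteq> Y \<times> X" using sub \<xi> by auto
    have s: "{(\<eta>, \<xi>)} \<subseteq> Y \<times> X" using \<xi> \<eta> by auto
    \<comment> \<open>The relation \<open>{(\<eta>, \<xi>)}\<close> moves the standard base point of \<open>Y\<close> to that of \<open>X\<close>, so that
      \<open>A \<times> A\<close> contains the composition of \<open>f\<close>, \<open>E\<close> and this relation.\<close>
    have "star_rel U E O star_rel U {(\<eta>, \<xi>)} \<subseteq> star_rel U (E O {(\<eta>, \<xi>)})"
      by (rule star_rel_comp[OF Y Y X sub s sub2]) simp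
    moreover have "(star U \<eta>, star U \<xi>) \<in> star_rel U {(\<eta>, \<xi>)}"
      using star_rel_star[OF Y X s] by simp
    ultimately have "(star_map U X f x, star U \<xi>) \<in> star_rel U (E O {(\<eta>, \<xi>)})"
      using E(2) by blast
    moreover have "star_rel U (graph X f) O star_rel U (E O {(\<eta>, \<xi>)}) \<subseteq> star_rel U (A \<times> A)"
      by (rule star_rel_comp[OF X Y X _ sub2 AX]) (use fX \<xi>A in \<open>auto simp: A_def\<close>)
    ultimately have "(x, star U \<xi>) \<in> star_rel U (A \<times> A)"
      using star_map_graph[OF X Y fX xX] by blast
    with A show ?thesis by (auto simp: finitely_close_def)
  qed
  then show ?thesis
    using x star_map_in[OF X Y fX xX] by (auto simp: INF_pts_def FIN_pts_def)
qed

lemma bornotopic_id_close: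
  assumes X: "standard_set U X" and Y: "standard_set U Y" and C: "coarse_structure X C"
    and f: "f ` X \<subseteq> Y" and g: "g ` Y \<subseteq> X" and b: "bornotopic X C (g \<circ> f) id"
    and x: "x \<in> star_set U X"
  shows "finitely_close U C (star_map U Y g (star_map U X f x)) x"
proof -
  define H where "H = {(g (f x), x) | x. x \<in> X}"
  have H: "H \<in> C" using b by (simp add: bornotopic_def H_def)
  then have H': "H\<inverse> \<in> C" using C by (auto simp: coarse_structure_def)
  have "star_rel U (graph X f) O star_rel U (graph Y g) \<subseteq> star_rel U (H\<inverse>)"
    by (rule star_rel_comp[OF X Y X]) (use f g in \<open>auto simp: H_def\<close>)
  then have "(x, star_map U Y g (star_map U X f x)) \<in> star_rel U (H\<inverse>)"
    using star_map_graph[OF X Y f x] star_map_graph[OF Y X g star_map_in[OF X Y f x]] by blast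
  with H' have "finitely_close U C x (star_map U Y g (star_map U X f x))"
    by (auto simp: finitely_close_def)
  then show ?thesis by (rule finitely_close_sym[OF X C])
qed


section \<open>Components at infinity\<close>

lemma iota_equiv_INF:
  "iota_equiv U X C \<xi> x y \<Longrightarrow> x \<in> INF_pts U X C \<xi> \<and> y \<in> INF_pts U X C \<xi>"
  by (simp add: iota_equiv_def)

lemma iota_equiv_refl:
  assumes X: "standard_set U X" and C: "coarse_structure X C" and x: "x \<in> INF_pts U X C \<xi>"
  shows "iota_equiv U X C \<xi> x x"
proof -
  have xX: "x \<in> star_set U X" using x by (simp add: INF_pts_def)
  obtain t where t: "internal U t" "hseq X (hzero U) t" "(hzero U, x) \<in> nrel t"
    "\<And>i y. (i, y) \<in> nrel t \<Longrightarrow> y = x"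
    using hseq_const[OF X xX] by blast
  have "finitely_close U C z w" if "hstep t z w" for z w
  proof -
    have "z = x" "w = x" using that t(4) unfolding hstep_iff[OF t(2)] by blast+
    then show ?thesis using finitely_close_refl[OF X C xX] by simp
  qed
  moreover have "z \<in> INF_pts U X C \<xi>" if "(i, z) \<in> nrel t" for i z
    using t(4)[OF that] x by simp
  ultimately show ?thesis
    unfolding iota_equiv_iff using t(1-3) hzero_in by blast
qed

text \<open>
  Symmetry, transitivity and the equivalence of finitely close infinite points are all special
  cases of this lemma.
\<close>

lemma iota_equiv_join:
  assumes X: "standard_set U X" and C: "coarse_structure X C"
    and xy: "iota_equiv U X C \<xi> x y" and xy': "iota_equiv U X C \<xi> x' y'"
    and close: "finitely_close U C y y'"
  shows "iota_equiv U X C \<xi> x x'"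
proof -
  obtain n s where n: "n \<in> hnat U" and s: "internal U s" "hseq X n s"
      "(hzero U, x) \<in> nrel s" "(n, y) \<in> nrel s"
      "\<And>i z. (i, z) \<in> nrel s \<Longrightarrow> z \<in> INF_pts U X C \<xi>"
      "\<And>z w. hstep s z w \<Longrightarrow> finitely_close U C z w"
    using xy unfolding iota_equiv_iff by blast
  obtain m s' where m: "m \<in> hnat U" and s': "internal U s'" "hseq X m s'"
      "(hzero U, x') \<in> nrel s'" "(m, y') \<in> nrel s'"
      "\<And>i z. (i, z) \<in> nrel s' \<Longrightarrow> z \<in> INF_pts U X C \<xi>"
      "\<And>z w. hstep s' z w \<Longrightarrow> finitely_close U C z w"
    using xy' unfolding iota_equiv_iff by blast
  obtain k t where k: "k \<in> hnat U" and t: "internal U t" "hseq X k t"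
    and joins: "joins (nmem U) (star U nats) (hzero U) (star U suc_graph) (star U (code U X)) s n s' m t k"
    by (rule hseq_join[OF X s(1) s'(1) n m s(2) s'(2)])
  note j = joins[unfolded joins_def nmem_code star_nats]
  have "(hzero U, x) \<in> nrel t"
    using j s(3) hseq_relD(3)[OF s(2,3)] by blast
  moreover have "(k, x') \<in> nrel t"
    using j s'(3) hseq_relD(3)[OF s'(2,3)] by blast
  moreover have "z \<in> INF_pts U X C \<xi>" if iz: "(i, z) \<in> nrel t" for i z
  proof -
    obtain l where "(l, z) \<in> nrel s \<or> (l, z) \<in> nrel s'"
      using j iz hseq_relD[OF t(2) iz] by blast
    with s(5) s'(5) show ?thesis by blast
  qed
  moreover have "finitely_close U C z w" if zw: "hstep t z w" for z w
  proof -
    have "z \<in> star_set U X" "w \<in> star_set U X"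
      using zw hseq_relD(3)[OF t(2)] unfolding hstep_iff[OF t(2)] by blast+
    with j zw consider "hstep s z w" | "hstep s' w z" | "(n, z) \<in> nrel s" "(m, w) \<in> nrel s'"
      by blast
    then show ?thesis
    proof cases
      case 1
      then show ?thesis by (rule s(6))
    next
      case 2
      then show ?thesis by (rule finitely_close_sym[OF X C s'(6)])
    next
      case 3
      with is_seq_unique[OF s(2)] is_seq_unique[OF s'(2)] s(4) s'(4) close
      show ?thesis by metis
    qed
  qed
  ultimately show ?thesis
    unfolding iota_equiv_iff using k t by blast
qed

lemma iota_equiv_sym:
  assumes "standard_set U X" "coarse_structure X C" "iota_equiv U X C \<xi> x y"
  shows "iota_equiv U X C \<xi> y x"
proof -
  have y: "y \<in> INF_pts U X C \<xi>" using iota_equiv_INF[OF assms(3)] by simp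
  then have "finitely_close U C y y"
    using finitely_close_refl[OF assms(1,2)] by (simp add: INF_pts_def)
  with iota_equiv_join[OF assms(1,2) iota_equiv_refl[OF assms(1,2) y] assms(3)]
  show ?thesis by blast
qed

lemma iota_equiv_trans:
  assumes "standard_set U X" "coarse_structure X C"
    "iota_equiv U X C \<xi> x y" "iota_equiv U X C \<xi> y z"
  shows "iota_equiv U X C \<xi> x z"
proof -
  have "y \<in> INF_pts U X C \<xi>" using iota_equiv_INF[OF assms(3)] by simp
  then have "finitely_close U C y y"
    using finitely_close_refl[OF assms(1,2)] by (simp add: INF_pts_def)
  with iota_equiv_join[OF assms(1-3) iota_equiv_sym[OF assms(1,2,4)]]
  show ?thesis by blast
qed

lemma iota_equiv_close:
  assumes "standard_set U X" "coarse_structure X C" "x \<in> INF_pts U X C \<xi>" "y \<in> INF_pts U X C \<xi>"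
    "finitely_close U C x y"
  shows "iota_equiv U X C \<xi> x y"
  by (rule iota_equiv_join[OF assms(1,2) iota_equiv_refl iota_equiv_refl]) (use assms in auto)

lemma iota_class_eq_iff:
  assumes "standard_set U X" "coarse_structure X C" "x \<in> INF_pts U X C \<xi>"
  shows "iota_class U X C \<xi> x = iota_class U X C \<xi> y \<longleftrightarrow> iota_equiv U X C \<xi> x y"
  unfolding iota_class_def
  using iota_equiv_refl[OF assms] iota_equiv_sym[OF assms(1,2)] iota_equiv_trans[OF assms(1,2)]
  by blast

lemma iota_equiv_star_map:
  assumes X: "standard_set U X" and PX: "pointed_coarse_space X CX \<xi>"
    and Y: "standard_set U Y" and PY: "pointed_coarse_space Y CY \<eta>"
    and f: "coarse_map X CX \<xi> Y CY \<eta> f" and xy: "iota_equiv U X CX \<xi> x y"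
  shows "iota_equiv U Y CY \<eta> (star_map U X f x) (star_map U X f y)"
proof -
  have CX: "coarse_structure X CX" using PX by (simp add: pointed_coarse_space_def)
  have fX: "f ` X \<subseteq> Y" and born: "bornologous CX CY f"
    using f by (auto simp: coarse_map_def pointed_map_def)
  obtain n s where n: "n \<in> hnat U" and s: "internal U s" "hseq X n s"
      "(hzero U, x) \<in> nrel s" "(n, y) \<in> nrel s"
      "\<And>i z. (i, z) \<in> nrel s \<Longrightarrow> z \<in> INF_pts U X CX \<xi>"
      "\<And>z w. hstep s z w \<Longrightarrow> finitely_close U CX z w"
    using xy unfolding iota_equiv_iff by blast
  obtain t where t: "internal U t" "hseq Y n t"
    "\<And>i x. (i, x) \<in> nrel t \<longleftrightarrow> (\<exists>z. (i, z) \<in> nrel s \<and> x = star_map U X f z)"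
    using hseq_image[OF X Y fX s(1) n s(2)] by blast
  have "z \<in> INF_pts U Y CY \<eta>" if "(i, z) \<in> nrel t" for i z
    using that s(5) star_map_INF[OF X PX Y PY f] by (auto simp: t(3))
  moreover have "finitely_close U CY z w" if zw: "hstep t z w" for z w
  proof -
    obtain i a b where "(i, a) \<in> nrel s" "z = star_map U X f a"
        "(hsuc U i, b) \<in> nrel s" "w = star_map U X f b"
      using zw unfolding hstep_iff[OF t(2)] t(3) by blast
    then show ?thesis
      using s(6)[of a b] finitely_close_star_map[OF X CX Y fX born] unfolding hstep_iff[OF s(2)]
      by blast
  qed
  ultimately show ?thesis
    unfolding iota_equiv_iff using n t s(3,4) by blast
qed

end

theorem corollary3p12:
  fixes U :: "('u, 'v) nsuniv"
    and X Y :: "'u set" and CX CY :: "('u \<times> 'u) set set" and \<xi> \<eta> :: 'u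
    and f :: "'u \<Rightarrow> 'u"
  assumes "nonstandard_universe U"
    and "standard_set U X" and "pointed_coarse_space X CX \<xi>"
    and "standard_set U Y" and "pointed_coarse_space Y CY \<eta>"
    and "coarse_equivalence X CX \<xi> Y CY \<eta> f"
  shows "(\<forall>x \<in> INF_pts U X CX \<xi>. iota_map U X Y CY \<eta> f (iota_class U X CX \<xi> x)
            = iota_class U Y CY \<eta> (star_map U X f x))
       \<and> bij_betw (iota_map U X Y CY \<eta> f) (iota U X CX \<xi>) (iota U Y CY \<eta>)"
proof -
  interpret nonstandard_universe U by (fact assms(1))
  note X = assms(2) and PX = assms(3) and Y = assms(4) and PY = assms(5)
  have CX: "coarse_structure X CX" and CY: "coarse_structure Y CY"
    using PX PY by (auto simp: pointed_coarse_space_def)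
  obtain g where f: "coarse_map X CX \<xi> Y CY \<eta> f" and g: "coarse_map Y CY \<eta> X CX \<xi> g"
    and gf: "bornotopic X CX (g \<circ> f) id" and fg: "bornotopic Y CY (f \<circ> g) id"
    using assms(6) by (auto simp: coarse_equivalence_def)
  have fX: "f ` X \<subseteq> Y" and gY: "g ` Y \<subseteq> X"
    using f g by (auto simp: coarse_map_def pointed_map_def)
  define F where "F = star_map U X f"
  define G where "G = star_map U Y g"
  have F_INF: "F x \<in> INF_pts U Y CY \<eta>" if "x \<in> INF_pts U X CX \<xi>" for x
    unfolding F_def by (rule star_map_INF[OF X PX Y PY f that])
  have G_INF: "G y \<in> INF_pts U X CX \<xi>" if "y \<in> INF_pts U Y CY \<eta>" for y
    unfolding G_def by (rule star_map_INF[OF Y PY X PX g that])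
  have F_equiv: "iota_equiv U Y CY \<eta> (F x) (F x')" if "iota_equiv U X CX \<xi> x x'" for x x'
    unfolding F_def by (rule iota_equiv_star_map[OF X PX Y PY f that])
  have G_equiv: "iota_equiv U X CX \<xi> (G y) (G y')" if "iota_equiv U Y CY \<eta> y y'" for y y'
    unfolding G_def by (rule iota_equiv_star_map[OF Y PY X PX g that])
  have GF: "iota_equiv U X CX \<xi> (G (F x)) x" if x: "x \<in> INF_pts U X CX \<xi>" for x
  proof (rule iota_equiv_close[OF X CX G_INF[OF F_INF[OF x]] x])
    show "finitely_close U CX (G (F x)) x"
      unfolding F_def G_def using x by (intro bornotopic_id_close[OF X Y CX fX gY gf]) (simp add: INF_pts_def)
  qed
  have FG: "iota_equiv U Y CY \<eta> (F (G y)) y" if y: "y \<in> INF_pts U Y CY \<eta>" for y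
  proof (rule iota_equiv_close[OF Y CY F_INF[OF G_INF[OF y]] y])
    show "finitely_close U CY (F (G y)) y"
      unfolding F_def G_def using y by (intro bornotopic_id_close[OF Y X CY gY fX fg]) (simp add: INF_pts_def)
  qed
  note X_eq = iota_class_eq_iff[OF X CX] and Y_eq = iota_class_eq_iff[OF Y CY]
  have map: "iota_map U X Y CY \<eta> f (iota_class U X CX \<xi> x) = iota_class U Y CY \<eta> (F x)"
    if x: "x \<in> INF_pts U X CX \<xi>" for x
    unfolding iota_map_def F_def[symmetric]
  proof (rule the_equality)
    show "\<exists>x'\<in>iota_class U X CX \<xi> x. iota_class U Y CY \<eta> (F x) = iota_class U Y CY \<eta> (F x')"
      using iota_equiv_refl[OF X CX x] by (auto simp: iota_class_def)
    show "d = iota_class U Y CY \<eta> (F x)"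
      if d: "\<exists>x'\<in>iota_class U X CX \<xi> x. d = iota_class U Y CY \<eta> (F x')" for d
    proof -
      obtain x' where x': "iota_equiv U X CX \<xi> x x'" "d = iota_class U Y CY \<eta> (F x')"
        using d by (auto simp: iota_class_def)
      from F_equiv[OF x'(1)] show ?thesis
        unfolding x'(2) by (simp add: Y_eq[OF F_INF[OF x], symmetric])
    qed
  qed
  have "inj_on (iota_map U X Y CY \<eta> f) (iota U X CX \<xi>)"
  proof (rule inj_onI)
    fix c c' assume "c \<in> iota U X CX \<xi>" "c' \<in> iota U X CX \<xi>"
      and eq: "iota_map U X Y CY \<eta> f c = iota_map U X Y CY \<eta> f c'"
    then obtain x x' where x: "x \<in> INF_pts U X CX \<xi>" "c = iota_class U X CX \<xi> x"
      and x': "x' \<in> INF_pts U X CX \<xi>" "c' = iota_class U X CX \<xi> x'"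
      by (auto simp: iota_def)
    have "iota_equiv U Y CY \<eta> (F x) (F x')"
      using eq Y_eq[OF F_INF[OF x(1)]] by (simp add: x(2) x'(2) map x(1) x'(1))
    from G_equiv[OF this] have "iota_equiv U X CX \<xi> x (G (F x'))"
      by (rule iota_equiv_trans[OF X CX iota_equiv_sym[OF X CX GF[OF x(1)]]])
    from iota_equiv_trans[OF X CX this GF[OF x'(1)]] show "c = c'"
      unfolding x(2) x'(2) by (simp add: X_eq[OF x(1)])
  qed
  moreover have "iota_map U X Y CY \<eta> f ` iota U X CX \<xi> = iota U Y CY \<eta>"
  proof (intro equalityI subsetI)
    fix d assume "d \<in> iota_map U X Y CY \<eta> f ` iota U X CX \<xi>"
    then show "d \<in> iota U Y CY \<eta>"
      using map F_INF by (auto simp: iota_def)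
  next
    fix d assume "d \<in> iota U Y CY \<eta>"
    then obtain y where y: "y \<in> INF_pts U Y CY \<eta>" "d = iota_class U Y CY \<eta> y"
      by (auto simp: iota_def)
    have "d = iota_class U Y CY \<eta> (F (G y))"
      unfolding y(2) using FG[OF y(1)] by (simp add: Y_eq[OF F_INF[OF G_INF[OF y(1)]], symmetric])
    also have "\<dots> = iota_map U X Y CY \<eta> f (iota_class U X CX \<xi> (G y))"
      by (simp add: map G_INF y(1))
    finally show "d \<in> iota_map U X Y CY \<eta> f ` iota U X CX \<xi>"
      using G_INF[OF y(1)] by (auto simp: iota_def)
  qed
  ultimately show ?thesis
    using map unfolding F_def bij_betw_def by blast
qed

end
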